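(* Every nonnegative integer $n$ can be written as $p_5(w)+2p_5(x)+3p_5(y)+4p_5(z)$ with $w,x,y,z$ nonnegative integers.
   Context: For $k\in\mathbb{Z}$, $p_5(k)=k(3k-1)/2$ (pentagonal numbers when $k\ge 0$). *)

theory Defs
  imports Main
begin

definition p5 :: "int \<Rightarrow> int" where
  "p5 k = k * (3 * k - 1) div 2"

end

theory Submission
  imports Defs "HOL-Analysis.Analysis" "HOL-Number_Theory.Number_Theory" "HOL-Computational_Algebra.Squarefree"
begin

text \<open>
  Cauchy's method: write \<open>n = 3 a - b\<close> and look for integers with \<open>w + 2 x + 3 y + 4 z = 2 b\<close> and
  \<open>w\<^sup>2 + 2 x\<^sup>2 + 3 y\<^sup>2 + 4 z\<^sup>2 = 2 a\<close>. By the Cauchy--Schwarz inequality they are nonnegative as soon as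
  \<open>2 b\<^sup>2 \<ge> 9 a\<close>. Diagonalising, such integers exist if \<open>m = 5 a - b\<^sup>2\<close> equals \<open>X\<^sup>2 + 2 Y\<^sup>2 + 3 Z\<^sup>2\<close> subject to
  a congruence modulo 5, which can always be achieved when 5 does not divide \<open>b\<close> and \<open>(Y, Z) \<noteq> (0, 0)\<close>; the
  latter holds if \<open>m\<close> is not a square. Finally, \<open>m\<close> has this shape if \<open>6 m\<close> is a sum of three squares.
  For large \<open>n\<close> there is room to choose \<open>a\<close> and \<open>b\<close> in suitable residue classes; the remaining \<open>n\<close> are
  checked by computation.

  The three squares theorem is needed only for \<open>N\<close> congruent to 1 or 2 modulo 4. For squarefree \<open>N\<close> one picks a
  prime \<open>q \<equiv> 1\<close> modulo 4 such that \<open>-q\<close> is a square modulo \<open>N\<close> and \<open>N\<close> is a square modulo \<open>q\<close>. A pigeonhole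
  argument solves \<open>z\<^sup>2 + q u\<^sup>2 = N t\<^sup>2\<close>, so \<open>N\<close> is a sum of three rational squares, and the descent of Davenport
  and Cassels makes them integral. The prime \<open>q\<close> is prescribed by quadratic characters only, so of
  Dirichlet's theorem just the case of real characters is required; there \<open>L(1,\<psi>) \<noteq> 0\<close> follows from
  Monsky's argument with Lambert series.
\<close>

section \<open>Primes with prescribed real characters\<close>

text \<open>Only periodicity ties \<psi> to \<open>M\<close>; values at non-units are free. Thus one
  function serves as a character modulo every multiple of its period.\<close>

definition real_character :: "nat \<Rightarrow> (nat \<Rightarrow> real) \<Rightarrow> bool" where
  "real_character M \<psi> \<longleftrightarrow>
     (\<forall>m n. \<psi> (m * n) = \<psi> m * \<psi> n) \<and> \<psi> 1 = 1 \<and> (\<forall>n. \<psi> n \<in> {-1, 0, 1}) \<and> (\<forall>n. \<psi> (n + M) = \<psi> n)"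

text \<open>These are the power series coefficients of the Lambert series of \<psi>.\<close>

definition divisor_sum :: "(nat \<Rightarrow> real) \<Rightarrow> nat \<Rightarrow> real" where
  "divisor_sum \<psi> n = (\<Sum>d | d dvd n. \<psi> d)"

definition lseries :: "(nat \<Rightarrow> real) \<Rightarrow> real \<Rightarrow> real" where
  "lseries \<psi> s = (\<Sum>n. \<psi> (Suc n) * real (Suc n) powr (-s))"

text \<open>Summation by parts: what appears besides the boundary term are differences of
  \<open>b\<close>, which are nonnegative and telescope.\<close>

lemma abel_summation_bound:
  fixes g b :: "nat \<Rightarrow> real"
  assumes G: "\<And>n. \<bar>\<Sum>k<n. g k\<bar> \<le> B" and dec: "\<And>n. b (Suc n) \<le> b n" and pos: "\<And>n. 0 \<le> b n"
  shows "\<bar>\<Sum>k<n. g k * b k\<bar> \<le> B * b 0"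
proof -
  define G where "G n = (\<Sum>k<n. g k)" for n
  have "(\<Sum>k<n. g k * b k) = G n * b n + (\<Sum>k<n. G (Suc k) * (b k - b (Suc k)))"
    by (induction n) (simp_all add: G_def algebra_simps)
  then have "\<bar>\<Sum>k<n. g k * b k\<bar> \<le> \<bar>G n * b n\<bar> + \<bar>\<Sum>k<n. G (Suc k) * (b k - b (Suc k))\<bar>"
    by linarith
  also have "\<bar>G n * b n\<bar> \<le> B * b n"
    using G[of n] pos by (auto simp: abs_mult G_def intro: mult_right_mono)
  also have "\<bar>\<Sum>k<n. G (Suc k) * (b k - b (Suc k))\<bar> \<le> (\<Sum>k<n. \<bar>G (Suc k) * (b k - b (Suc k))\<bar>)"
    by (rule sum_abs)
  also have "\<dots> \<le> (\<Sum>k<n. B * (b k - b (Suc k)))"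
    unfolding abs_mult G_def
  proof (rule sum_mono)
    fix k
    show "\<bar>\<Sum>k<Suc k. g k\<bar> * \<bar>b k - b (Suc k)\<bar> \<le> B * (b k - b (Suc k))"
      using G[of "Suc k"] dec[of k] by (metis abs_of_nonneg diff_ge_0_iff_ge mult_right_mono)
  qed
  also have "\<dots> = B * (b 0 - b n)"
    by (simp add: sum_distrib_left[symmetric] sum_lessThan_telescope')
  finally show ?thesis
    by (simp add: algebra_simps)
qed

lemma sum_lessThan_add:
  fixes f :: "nat \<Rightarrow> 'a :: comm_monoid_add"
  shows "(\<Sum>k<m + n. f k) = (\<Sum>k<m. f k) + (\<Sum>k<n. f (m + k))"
  by (induction n) (simp_all add: add.assoc)

lemma prime_power_decomposition:
  fixes n :: nat
  assumes "n > 1"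
  obtains p a m where "prime p" "\<not> p dvd m" "n = p ^ a * m" "0 < m" "m < n"
proof -
  obtain p where p: "prime p" "p dvd n"
    using prime_factor_nat[of n] assms by auto
  define a where "a = multiplicity p n"
  have "p ^ a dvd n" by (simp add: a_def multiplicity_dvd)
  then obtain m where m: "n = p ^ a * m" ..
  have "\<not> p dvd m"
  proof
    assume "p dvd m"
    then have "p ^ Suc a dvd n" unfolding m by (simp add: mult.commute mult_dvd_mono)
    then have "Suc a \<le> a"
      unfolding a_def using assms p by (subst (asm) power_dvd_iff_le_multiplicity) auto
    then show False by simp
  qed
  moreover have "a > 0"
    unfolding a_def using p assms by (simp add: prime_multiplicity_gt_zero_iff)
  then have "p ^ a > 1" using p prime_gt_1_nat one_less_power by blast
  moreover have "m > 0" using m assms by (cases m) auto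
  ultimately show ?thesis using that p m by (metis mult_less_cancel2 nat_mult_1)
qed

section \<open>Real characters and their divisor sums\<close>

context
  fixes M :: nat and \<psi> :: "nat \<Rightarrow> real"
  assumes char: "real_character M \<psi>"
begin

lemma character_mult: "\<psi> (m * n) = \<psi> m * \<psi> n"
  using char by (auto simp: real_character_def)

lemma character_1: "\<psi> 1 = 1" "\<psi> (Suc 0) = 1"
  using char by (auto simp: real_character_def)

lemma character_cases: "\<psi> n = -1 \<or> \<psi> n = 0 \<or> \<psi> n = 1"
  using char by (auto simp: real_character_def)

lemma character_abs_le: "\<bar>\<psi> n\<bar> \<le> 1"
  using character_cases[of n] by auto

lemma character_power: "\<psi> (m ^ i) = \<psi> m ^ i"
  by (induction i) (use character_1 in \<open>auto simp: character_mult\<close>)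

lemma character_periodic_mult: "\<psi> (n + q * M) = \<psi> n"
proof (induction q)
  case (Suc q)
  have "\<psi> (n + Suc q * M) = \<psi> ((n + q * M) + M)"
    by (simp add: ac_simps)
  also have "\<dots> = \<psi> (n + q * M)"
    using char unfolding real_character_def by blast
  finally show ?case using Suc by simp
qed simp

lemma character_mod: "\<psi> (n mod M) = \<psi> n"
  using character_periodic_mult[of "n mod M" "n div M"] by simp

text \<open>Multiplication by \<open>c\<close> permutes the residues modulo \<open>M\<close>, so the
  sum equals its own negative.\<close>

lemma character_sum_eq_0:
  assumes "coprime c M" "\<psi> c = -1"
  shows "(\<Sum>k<M. \<psi> k) = 0"
proof (cases "M = 0")
  case False
  have inj: "inj_on (\<lambda>k. c * k mod M) {..<M}"
  proof (rule inj_onI)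
    fix a b assume "a \<in> {..<M}" "b \<in> {..<M}" "c * a mod M = c * b mod M"
    then have "[c * a = c * b] (mod M)" by (simp add: cong_def)
    then have "[a = b] (mod M)" using assms(1) by (simp add: cong_mult_lcancel_nat)
    then show "a = b" using \<open>a \<in> _\<close> \<open>b \<in> _\<close> by (simp add: cong_def)
  qed
  have "(\<lambda>k. c * k mod M) ` {..<M} = {..<M}"
    using False inj by (intro endo_inj_surj) auto
  then have "(\<Sum>k<M. \<psi> k) = (\<Sum>k<M. \<psi> (c * k mod M))"
    using sum.reindex[OF inj, of \<psi>] by (simp add: o_def)
  also have "\<dots> = - (\<Sum>k<M. \<psi> k)"
    by (simp add: character_mod character_mult assms(2) sum_negf)
  finally show ?thesis by simp
qed simp

text \<open>Full periods contribute 0, leaving fewer than \<open>M\<close> terms; the extra 1 pays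
  for the term at 0 that the index shift drops.\<close>

lemma character_partial_sums_bounded:
  assumes "(\<Sum>k<M. \<psi> k) = 0" "M > 0"
  shows "\<bar>\<Sum>k<n. \<psi> (Suc k)\<bar> \<le> real M + 1"
proof -
  have period: "(\<Sum>k<q * M. \<psi> k) = 0" for q
  proof (induction q)
    case (Suc q)
    have "(\<Sum>k<Suc q * M. \<psi> k) = (\<Sum>k<q * M + M. \<psi> k)" by (simp add: add.commute)
    also have "\<dots> = (\<Sum>k<q * M. \<psi> k) + (\<Sum>k<M. \<psi> (k + q * M))"
      by (subst sum_lessThan_add) (simp add: add.commute)
    finally show ?case using Suc assms by (simp add: character_periodic_mult)
  qed simp
  have "(\<Sum>k<m. \<psi> k) = (\<Sum>k<m mod M. \<psi> k)" for m
  proof -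
    have "(\<Sum>k<m. \<psi> k) = (\<Sum>k<(m div M) * M + m mod M. \<psi> k)" by simp
    also have "\<dots> = (\<Sum>k<(m div M) * M. \<psi> k) + (\<Sum>k<m mod M. \<psi> (k + (m div M) * M))"
      by (subst sum_lessThan_add) (simp add: add.commute)
    finally show ?thesis by (simp add: character_periodic_mult period)
  qed
  moreover have "\<bar>\<Sum>k<m mod M. \<psi> k\<bar> \<le> real M" for m
  proof -
    have "\<bar>\<Sum>k<m mod M. \<psi> k\<bar> \<le> (\<Sum>k<m mod M. \<bar>\<psi> k\<bar>)" by (rule sum_abs)
    also have "\<dots> \<le> (\<Sum>k<m mod M. 1)" by (intro sum_mono character_abs_le)
    also have "\<dots> \<le> real M" using assms(2) by (simp add: less_imp_le)
    finally show ?thesis .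
  qed
  ultimately have le: "\<bar>\<Sum>k<m. \<psi> k\<bar> \<le> real M" for m by metis
  have "(\<Sum>k<n. \<psi> (Suc k)) = (\<Sum>k<Suc n. \<psi> k) - \<psi> 0"
    by (simp add: sum.lessThan_Suc_shift del: sum.lessThan_Suc)
  then show ?thesis using le[of "Suc n"] character_abs_le[of 0] by linarith
qed

text \<open>By unique factorisation the divisors are exactly the \<open>p ^ i * d\<close> with
  \<open>i \<le> a\<close> and \<open>d dvd m\<close>, without repetition.\<close>

lemma divisor_sum_prime_power_mult:
  assumes p: "prime p" and "\<not> p dvd m"
  shows "divisor_sum \<psi> (p ^ a * m) = (\<Sum>i\<le>a. \<psi> p ^ i) * divisor_sum \<psi> m"
proof -
  have "m > 0" using assms(2) by (cases m) auto
  have inj: "inj_on (\<lambda>(i, d). p ^ i * d) ({..a} \<times> {d. d dvd m})"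
  proof (rule inj_onI, clarify)
    fix i d j e assume *: "d dvd m" "e dvd m" "p ^ i * d = p ^ j * e"
    have nd: "\<not> p dvd d" "\<not> p dvd e" using * assms(2) dvd_trans by blast+
    have "multiplicity p (p ^ i * d) = i" "multiplicity p (p ^ j * e) = j"
      using p nd by (auto intro!: multiplicity_eqI simp: prime_gt_0_nat dvd_mult_cancel1 mult.commute)
    then have "i = j" using * by simp
    then show "i = j \<and> d = e" using * p by (simp add: prime_gt_0_nat)
  qed
  have img: "(\<lambda>(i, d). p ^ i * d) ` ({..a} \<times> {d. d dvd m}) = {d. d dvd p ^ a * m}"
  proof (intro equalityI subsetI)
    fix d assume "d \<in> {d. d dvd p ^ a * m}"
    then obtain b c where bc: "d = b * c" "b dvd p ^ a" "c dvd m"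
      by (auto dest: division_decomp)
    then obtain i where "i \<le> a" "b = p ^ i"
      using p by (auto simp: divides_primepow_nat)
    then show "d \<in> (\<lambda>(i, d). p ^ i * d) ` ({..a} \<times> {d. d dvd m})"
      using bc by force
  qed (auto intro!: mult_dvd_mono le_imp_power_dvd)
  have "divisor_sum \<psi> (p ^ a * m) = (\<Sum>(i, d)\<in>{..a} \<times> {d. d dvd m}. \<psi> (p ^ i * d))"
    unfolding divisor_sum_def img[symmetric] sum.reindex[OF inj]
    by (intro sum.cong) auto
  also have "\<dots> = (\<Sum>i\<le>a. \<Sum>d | d dvd m. \<psi> p ^ i * \<psi> d)"
    by (subst sum.cartesian_product) (simp add: character_mult character_power)
  finally show ?thesis
    by (simp add: divisor_sum_def sum_product)
qed

lemma divisor_sum_1: "divisor_sum \<psi> (Suc 0) = 1"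
proof -
  have "{d. d dvd Suc 0} = {1::nat}" by auto
  then show ?thesis using character_1 by (simp add: divisor_sum_def)
qed

lemma character_geometric_sum_nonneg: "(\<Sum>i\<le>a. \<psi> m ^ i) \<ge> 0"
  and character_geometric_sum_even: "(\<Sum>i\<le>2 * b. \<psi> m ^ i) \<ge> 1"
proof -
  consider "\<psi> m = 0" | "\<psi> m = 1" | "\<psi> m = -1"
    using character_cases by blast
  then have "(\<Sum>i\<le>a. \<psi> m ^ i) \<ge> 0 \<and> (\<Sum>i\<le>2 * b. \<psi> m ^ i) \<ge> 1"
  proof cases
    case 1
    have "(\<Sum>i\<le>k. (0::real) ^ i) = 1" for k
      by (induction k) auto
    with 1 show ?thesis by simp
  next
    case 3
    have "(\<Sum>i\<le>k. (-1::real) ^ i) = (if even k then 1 else 0)" for k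
      by (induction k) auto
    with 3 show ?thesis by simp
  qed simp
  then show "(\<Sum>i\<le>a. \<psi> m ^ i) \<ge> 0" "(\<Sum>i\<le>2 * b. \<psi> m ^ i) \<ge> 1" by blast+
qed

lemma divisor_sum_nonneg: "n > 0 \<Longrightarrow> divisor_sum \<psi> n \<ge> 0"
proof (induction n rule: less_induct)
  case (less n)
  show ?case
  proof (cases "n > 1")
    case True
    then obtain p a m where "prime p" "\<not> p dvd m" "n = p ^ a * m" "0 < m" "m < n"
      by (rule prime_power_decomposition)
    then show ?thesis
      using less.IH[of m] by (simp add: divisor_sum_prime_power_mult character_geometric_sum_nonneg)
  next
    case False
    then have "n = Suc 0" using less.prems by simp
    then show ?thesis by (simp add: divisor_sum_1)
  qed
qed

text \<open>Prime exponents in a square are even, so every local factor is at least 1.\<close>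

lemma divisor_sum_square: "n > 0 \<Longrightarrow> divisor_sum \<psi> (n\<^sup>2) \<ge> 1"
proof (induction n rule: less_induct)
  case (less n)
  show ?case
  proof (cases "n > 1")
    case True
    then obtain p a m where *: "prime p" "\<not> p dvd m" "n = p ^ a * m" "0 < m" "m < n"
      by (rule prime_power_decomposition)
    have "n\<^sup>2 = p ^ (2 * a) * m\<^sup>2"
      by (simp add: * power_mult_distrib power_mult[symmetric] mult.commute)
    moreover have "\<not> p dvd m\<^sup>2"
      using * prime_dvd_power by blast
    ultimately have "divisor_sum \<psi> (n\<^sup>2) = (\<Sum>i\<le>2 * a. \<psi> p ^ i) * divisor_sum \<psi> (m\<^sup>2)"
      using * by (simp add: divisor_sum_prime_power_mult)
    also have "\<dots> \<ge> 1 * 1"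
      using less.IH[of m] * character_geometric_sum_even[of p a] by (intro mult_mono) auto
    finally show ?thesis by simp
  next
    case False
    then have "n = Suc 0" using less.prems by simp
    then show ?thesis by (simp add: divisor_sum_1)
  qed
qed

end

section \<open>Lambert series of a real character\<close>

context
  fixes M :: nat and \<psi> :: "nat \<Rightarrow> real"
  assumes char: "real_character M \<psi>"
begin

text \<open>Expanding the quotients into geometric series and collecting equal exponents produces
  the coefficients \<open>divisor_sum\<close>. They are nonnegative, so only squares up to
  \<open>K\<^sup>2\<close> are kept, each contributing at least \<open>x ^ (K\<^sup>2)\<close>. The
  subtracted term pays for truncating all series at exponent \<open>R\<close>.\<close>

lemma lambert_partial_sum_ge:
  fixes x :: real
  assumes x: "0 < x" "x < 1" and K: "K\<^sup>2 \<le> R"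
  shows "(\<Sum>n=1..R. \<psi> n * (x ^ n / (1 - x ^ n))) \<ge> real K * x ^ (K\<^sup>2) - real R * x ^ R / (1 - x)"
proof -
  define T where "T n = (\<Sum>k=1..R div n. x ^ (n * k))" for n
  have approx: "\<bar>x ^ n / (1 - x ^ n) - T n\<bar> \<le> x ^ R / (1 - x)" if n: "n \<in> {1..R}" for n
  proof -
    define q where "q = R div n"
    have xn: "x ^ n < 1" "x ^ n \<le> x"
      using x n power_decreasing[of 1 n x] by (auto simp: power_less_one_iff)
    have "(1 - x ^ n) * T n = x ^ n - x ^ (n * Suc q)"
    proof -
      have "(1 - z) * (\<Sum>k=1..q. z ^ k) = z - z ^ Suc q" for z :: real
      proof (induction q)
        case (Suc q)
        have step: "(1 - z) * (\<Sum>k=1..Suc q. z ^ k) = (1 - z) * (\<Sum>k=1..q. z ^ k) + (1 - z) * z ^ Suc q"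
          by (simp add: distrib_left)
        show ?case unfolding step Suc by (simp add: algebra_simps)
      qed simp
      then show ?thesis
        unfolding T_def q_def[symmetric] by (simp only: power_mult)
    qed
    then have "x ^ n / (1 - x ^ n) - T n = x ^ (n * Suc q) / (1 - x ^ n)"
      using xn by (simp add: field_simps)
    moreover have "x ^ (n * Suc q) / (1 - x ^ n) \<le> x ^ R / (1 - x)"
    proof (intro frac_le)
      have "R \<le> n * Suc q"
        using n dividend_less_times_div[of n R] by (auto simp: q_def)
      then show "x ^ (n * Suc q) \<le> x ^ R" using x by (intro power_decreasing) auto
    qed (use x xn in auto)
    moreover have "x ^ (n * Suc q) / (1 - x ^ n) \<ge> 0"
      using x xn by simp
    ultimately show ?thesis by linarith
  qed
  have "(\<Sum>n=1..R. \<psi> n * T n) - (\<Sum>n=1..R. \<psi> n * (x ^ n / (1 - x ^ n)))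
      = (\<Sum>n=1..R. \<psi> n * (T n - x ^ n / (1 - x ^ n)))"
    by (simp add: sum_subtractf right_diff_distrib)
  also have "\<dots> \<le> (\<Sum>n=1..R. x ^ R / (1 - x))"
  proof (rule sum_mono)
    fix n assume n: "n \<in> {1..R}"
    have "\<psi> n * (T n - x ^ n / (1 - x ^ n)) \<le> \<bar>\<psi> n\<bar> * \<bar>T n - x ^ n / (1 - x ^ n)\<bar>"
      by (metis abs_ge_self abs_mult)
    also have "\<dots> \<le> 1 * (x ^ R / (1 - x))"
      using approx[OF n] character_abs_le[OF char, of n] by (intro mult_mono) auto
    finally show "\<psi> n * (T n - x ^ n / (1 - x ^ n)) \<le> x ^ R / (1 - x)" by simp
  qed
  also have "\<dots> = real R * x ^ R / (1 - x)" by simp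
  finally have 1: "(\<Sum>n=1..R. \<psi> n * (x ^ n / (1 - x ^ n))) \<ge> (\<Sum>n=1..R. \<psi> n * T n) - real R * x ^ R / (1 - x)"
    by linarith
  have "(\<Sum>n=1..R. \<psi> n * T n) = (\<Sum>(n, k)\<in>(SIGMA n:{1..R}. {1..R div n}). \<psi> n * x ^ (n * k))"
    by (simp add: T_def sum_distrib_left sum.Sigma)
  also have "\<dots> = (\<Sum>(m, d)\<in>(SIGMA m:{1..R}. {d. d dvd m}). \<psi> d * x ^ m)"
  proof (rule sum.reindex_bij_witness[of _ "\<lambda>(m, d). (d, m div d)" "\<lambda>(n, k). (n * k, n)"], goal_cases)
    case (2 a)
    then show ?case
      by (auto simp: less_eq_div_iff_mult_less_eq mult.commute split: prod.splits intro: Suc_leI)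
  next
    case (4 b)
    then show ?case
      by (auto split: prod.splits simp: div_le_mono Suc_le_eq dvd_pos_nat dest: dvd_imp_le intro: order_trans)
  qed (auto split: prod.splits)
  also have "\<dots> = (\<Sum>m=1..R. divisor_sum \<psi> m * x ^ m)"
    by (subst sum.Sigma[symmetric]) (auto simp: divisor_sum_def sum_distrib_right)
  also have "\<dots> \<ge> (\<Sum>m\<in>(\<lambda>k. k\<^sup>2) ` {1..K}. divisor_sum \<psi> m * x ^ m)"
  proof (rule sum_mono2)
    show "(\<lambda>k. k\<^sup>2) ` {1..K} \<subseteq> {1..R}"
    proof clarify
      fix k assume k: "k \<in> {1..K}"
      then have "k\<^sup>2 \<le> K\<^sup>2" by (simp add: power_mono)
      with K have "k\<^sup>2 \<le> R" by (rule order_trans[rotated])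
      then show "k\<^sup>2 \<in> {1..R}" using k by simp
    qed
  qed (use x divisor_sum_nonneg[OF char] in auto)
  moreover have "(\<Sum>m\<in>(\<lambda>k. k\<^sup>2) ` {1..K}. divisor_sum \<psi> m * x ^ m) = (\<Sum>k=1..K. divisor_sum \<psi> (k\<^sup>2) * x ^ (k\<^sup>2))"
    by (subst sum.reindex) (auto simp: inj_on_def)
  moreover have "\<dots> \<ge> (\<Sum>k=1..K. 1 * x ^ (K\<^sup>2))"
    using x divisor_sum_square[OF char] divisor_sum_nonneg[OF char]
    by (intro sum_mono mult_mono power_decreasing) (auto simp: power_mono)
  ultimately show ?thesis using 1 by simp
qed

end

text \<open>The difference, up to sign, of the coefficients of \<open>\<psi>(n + 1)\<close> in the Lambert series
  \<open>\<Sum> \<psi>(n) x\<^sup>n / (1 - x\<^sup>n)\<close> and in \<open>L(1,\<psi>) / (1 - x)\<close>.\<close>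

definition lambert_weight :: "real \<Rightarrow> nat \<Rightarrow> real" where
  "lambert_weight x n = 1 / (real (Suc n) * (1 - x)) - x ^ Suc n / (1 - x ^ Suc n)"

text \<open>Monotonicity reduces to the inequality \<open>step\<close> between geometric sums, which
  follows from the AM-GM bound \<open>q_ge\<close>. Writing \<open>x\<close> as
  \<open>y\<^sup>2\<close> makes the geometric mean of \<open>1, x, ..., x ^ N\<close> the plain
  power \<open>y ^ N\<close>.\<close>

lemma lambert_weight_monotone:
  fixes y :: real
  assumes y: "0 < y" "y < 1"
  shows "lambert_weight (y\<^sup>2) (Suc n) \<le> lambert_weight (y\<^sup>2) n" "0 \<le> lambert_weight (y\<^sup>2) n"
    "lambert_weight (y\<^sup>2) 0 = 1"
proof -
  define x where "x = y\<^sup>2"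
  have x: "0 < x" "x < 1"
    using y by (simp_all add: x_def power_less_one_iff)
  define q where "q N = (\<Sum>i<N. x ^ i)" for N
  have q_eq: "1 - x ^ N = (1 - x) * q N" for N
    unfolding q_def by (rule one_diff_power_eq)
  have q_pos: "q (Suc N) > 0" for N
    unfolding q_def using x by (intro sum_pos) auto
  have weight: "lambert_weight x N = (1 / real (Suc N) - x ^ Suc N / q (Suc N)) / (1 - x)" for N
    unfolding lambert_weight_def q_eq by (simp add: diff_divide_distrib mult.commute del: power_Suc of_nat_Suc)
  have q_ge: "q (Suc N) \<ge> real (Suc N) * y ^ N" for N
  proof -
    \<comment> \<open>The terms \<open>x ^ i\<close> and \<open>x ^ (N - i)\<close> are paired; each
      pair has geometric mean \<open>y ^ N\<close>.\<close>
    have "2 * q (Suc N) = (\<Sum>i<Suc N. x ^ i) + (\<Sum>i<Suc N. x ^ (N - i))"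
      using sum.nat_diff_reindex[of "\<lambda>i. x ^ i" "Suc N"] by (simp add: q_def)
    also have "\<dots> = (\<Sum>i<Suc N. x ^ i + x ^ (N - i))"
      by (simp add: sum.distrib)
    also have "\<dots> \<ge> (\<Sum>i<Suc N. 2 * y ^ N)"
    proof (rule sum_mono)
      fix i assume "i \<in> {..<Suc N}"
      then have "y ^ N = y ^ i * y ^ (N - i)"
        by (simp add: power_add[symmetric])
      moreover have "x ^ j = (y ^ j)\<^sup>2" for j
        by (simp add: x_def power_mult[symmetric] mult.commute)
      ultimately show "2 * y ^ N \<le> x ^ i + x ^ (N - i)"
        using sum_squares_bound[of "y ^ i" "y ^ (N - i)"] by (simp add: mult.assoc)
    qed
    finally show ?thesis by simp
  qed
  have step: "real (Suc n) * real (Suc (Suc n)) * x ^ Suc n \<le> q (Suc n) * q (Suc (Suc n))"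
  proof -
    have "x ^ Suc n \<le> y ^ n * y ^ Suc n"
    proof -
      have "x ^ Suc n = y ^ (2 * Suc n)" by (simp only: x_def power_mult)
      also have "\<dots> \<le> y ^ (n + Suc n)" using y by (intro power_decreasing) auto
      finally show ?thesis by (simp only: power_add)
    qed
    then have "real (Suc n) * real (Suc (Suc n)) * x ^ Suc n \<le> (real (Suc n) * y ^ n) * (real (Suc (Suc n)) * y ^ Suc n)"
      using mult_left_mono[of "x ^ Suc n" "y ^ n * y ^ Suc n" "real (Suc n) * real (Suc (Suc n))"]
      by (simp add: mult.assoc mult.left_commute del: power_Suc of_nat_Suc)
    also have "\<dots> \<le> q (Suc n) * q (Suc (Suc n))"
      using q_ge[of n] q_ge[of "Suc n"] y q_pos[of n] by (intro mult_mono) auto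
    finally show ?thesis .
  qed
  define Q where "Q = q (Suc n) * q (Suc (Suc n))"
  define D where "D = real (Suc n) * real (Suc (Suc n))"
  have Q: "Q > 0" and D: "D > 0"
    using q_pos[of n] q_pos[of "Suc n"] by (simp_all add: Q_def D_def)
  have "q (Suc (Suc n)) = 1 + x * q (Suc n)"
    unfolding q_def by (subst sum.lessThan_Suc_shift) (simp add: sum_distrib_left del: sum.lessThan_Suc)
  then have "x ^ Suc n * q (Suc (Suc n)) - x ^ Suc (Suc n) * q (Suc n) = x ^ Suc n"
    by (simp add: algebra_simps)
  then have "x ^ Suc n / q (Suc n) - x ^ Suc (Suc n) / q (Suc (Suc n)) = x ^ Suc n / Q"
    using q_pos[of n] q_pos[of "Suc n"] unfolding Q_def by (subst diff_frac_eq) (simp_all del: power_Suc)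
  also have "\<dots> \<le> 1 / D"
  proof -
    have "x ^ Suc n \<le> Q / D"
      using step D unfolding Q_def[symmetric] D_def[symmetric] by (simp add: pos_le_divide_eq mult.commute del: power_Suc)
    then show ?thesis
      using Q by (simp add: pos_divide_le_eq del: power_Suc)
  qed
  also have "\<dots> = 1 / real (Suc n) - 1 / real (Suc (Suc n))"
    by (simp add: D_def field_simps)
  finally have "1 / real (Suc (Suc n)) - x ^ Suc (Suc n) / q (Suc (Suc n)) \<le> 1 / real (Suc n) - x ^ Suc n / q (Suc n)"
    by linarith
  then show "lambert_weight (y\<^sup>2) (Suc n) \<le> lambert_weight (y\<^sup>2) n"
    unfolding x_def[symmetric] weight using x by (intro divide_right_mono) auto
  have "real (Suc n) * x ^ Suc n = (\<Sum>i<Suc n. x ^ Suc n)" by simp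
  also have "\<dots> \<le> q (Suc n)"
    unfolding q_def using x by (intro sum_mono power_decreasing) auto
  finally have "x ^ Suc n / q (Suc n) \<le> 1 / real (Suc n)"
    using q_pos[of n] by (simp add: field_simps)
  then show "0 \<le> lambert_weight (y\<^sup>2) n"
    unfolding x_def[symmetric] weight using x by simp
  show "lambert_weight (y\<^sup>2) 0 = 1"
    unfolding x_def[symmetric] using x by (simp add: lambert_weight_def field_simps)
qed

lemma powr_minus_le_inverse:
  fixes s :: real
  assumes "s \<ge> 1"
  shows "real (Suc K) powr (-s) \<le> 1 / real (Suc K)"
proof -
  have "real (Suc K) powr (-s) \<le> real (Suc K) powr (-1)"
    using assms by (intro powr_mono) auto
  then show ?thesis by (simp add: powr_minus_divide)
qed

section \<open>The L-series for \<open>s \<ge> 1\<close> and its value at 1\<close>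

context
  fixes M :: nat and \<psi> :: "nat \<Rightarrow> real" and B :: real
  assumes char: "real_character M \<psi>"
    and partial_sums: "\<And>n. \<bar>\<Sum>k<n. \<psi> (Suc k)\<bar> \<le> B"
begin

text \<open>Abel summation on a block, whose partial sums are differences of two initial ones; hence
  the factor 2.\<close>

lemma lseries_block_bound:
  assumes "s > 0"
  shows "\<bar>\<Sum>k=K..<K + n. \<psi> (Suc k) * real (Suc k) powr (-s)\<bar> \<le> 2 * B * real (Suc K) powr (-s)"
proof -
  have "\<bar>\<Sum>k<n. \<psi> (Suc (k + K))\<bar> \<le> 2 * B" for n
  proof -
    have "(\<Sum>k<K + n. \<psi> (Suc k)) = (\<Sum>k<K. \<psi> (Suc k)) + (\<Sum>k<n. \<psi> (Suc (k + K)))"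
      by (subst sum_lessThan_add) (simp add: add.commute)
    then show ?thesis
      using partial_sums[of "K + n"] partial_sums[of K] by linarith
  qed
  then have "\<bar>\<Sum>k<n. \<psi> (Suc (k + K)) * real (Suc (k + K)) powr (-s)\<bar> \<le> 2 * B * real (Suc (0 + K)) powr (-s)"
    using assms by (intro abel_summation_bound powr_mono2') auto
  also have "(\<Sum>k<n. \<psi> (Suc (k + K)) * real (Suc (k + K)) powr (-s)) = (\<Sum>k=K..<K + n. \<psi> (Suc k) * real (Suc k) powr (-s))"
    using sum.shift_bounds_nat_ivl[of "\<lambda>k. \<psi> (Suc k) * real (Suc k) powr (-s)" 0 K n]
    by (simp add: lessThan_atLeast0 add.commute)
  finally show ?thesis by simp
qed

lemma partial_sum_bound_nonneg: "B \<ge> 0"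
  using partial_sums[of 0] by simp

lemma lseries_summable:
  assumes "s \<ge> 1"
  shows "summable (\<lambda>k. \<psi> (Suc k) * real (Suc k) powr (-s))"
  unfolding summable_Cauchy
proof (intro allI impI)
  fix e :: real assume "e > 0"
  obtain N :: nat where N: "2 * B / e < real N"
    using reals_Archimedean2 by blast
  show "\<exists>N. \<forall>m\<ge>N. \<forall>n. norm (\<Sum>k=m..<n. \<psi> (Suc k) * real (Suc k) powr (-s)) < e"
  proof (intro exI allI impI)
    fix m n assume "N \<le> m"
    show "norm (\<Sum>k=m..<n. \<psi> (Suc k) * real (Suc k) powr (-s)) < e"
    proof (cases "m \<le> n")
      case True
      then have "norm (\<Sum>k=m..<n. \<psi> (Suc k) * real (Suc k) powr (-s)) \<le> 2 * B * real (Suc m) powr (-s)"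
        using lseries_block_bound[of s m "n - m"] assms by simp
      also have "\<dots> \<le> 2 * B * (1 / real (Suc m))"
        using partial_sum_bound_nonneg assms by (intro mult_left_mono powr_minus_le_inverse) auto
      also have "\<dots> < e"
      proof -
        have "2 * B / e < real (Suc m)" using N \<open>N \<le> m\<close> by linarith
        then show ?thesis using \<open>e > 0\<close> by (simp add: field_simps del: of_nat_Suc)
      qed
      finally show ?thesis .
    qed (use \<open>e > 0\<close> in simp)
  qed
qed

text \<open>The block bound with its right end sent to infinity. It does not depend on
  \<open>s\<close>, which yields uniform convergence on \<open>{1..}\<close>.\<close>

lemma lseries_tail_bound:
  assumes "s \<ge> 1"
  shows "\<bar>(\<Sum>k<K. \<psi> (Suc k) * real (Suc k) powr (-s)) - lseries \<psi> s\<bar> \<le> 2 * B / real (Suc K)"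
proof -
  define f where "f k = \<psi> (Suc k) * real (Suc k) powr (-s)" for k
  have "(\<lambda>n. \<Sum>k<n. f k) \<longlonglongrightarrow> lseries \<psi> s"
    using lseries_summable[OF assms] summable_LIMSEQ unfolding lseries_def f_def by blast
  then have "(\<lambda>n. \<bar>(\<Sum>k<K. f k) - (\<Sum>k<n. f k)\<bar>) \<longlonglongrightarrow> \<bar>(\<Sum>k<K. f k) - lseries \<psi> s\<bar>"
    by (intro tendsto_intros)
  moreover have "\<bar>(\<Sum>k<K. f k) - (\<Sum>k<n. f k)\<bar> \<le> 2 * B / real (Suc K)" if "n \<ge> K" for n
  proof -
    have "(\<Sum>k<n. f k) = (\<Sum>k<K. f k) + (\<Sum>k=K..<n. f k)"
      using that by (metis atLeast0LessThan le0 sum.atLeastLessThan_concat)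
    then have "\<bar>(\<Sum>k<K. f k) - (\<Sum>k<n. f k)\<bar> = \<bar>\<Sum>k=K..<K + (n - K). f k\<bar>"
      using that by simp
    also have "\<dots> \<le> 2 * B * real (Suc K) powr (-s)"
      unfolding f_def using assms by (intro lseries_block_bound) auto
    also have "\<dots> \<le> 2 * B * (1 / real (Suc K))"
      using partial_sum_bound_nonneg assms by (intro mult_left_mono powr_minus_le_inverse) auto
    finally show ?thesis by simp
  qed
  ultimately show ?thesis
    unfolding f_def[symmetric] by (intro LIMSEQ_le_const2) auto
qed

lemma lseries_continuous_on: "continuous_on {1..} (lseries \<psi>)"
proof (rule uniform_limit_theorem)
  show "uniform_limit {1..} (\<lambda>K s. \<Sum>k<K. \<psi> (Suc k) * real (Suc k) powr (-s)) (lseries \<psi>) sequentially"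
  proof (rule uniform_limitI)
    fix e :: real assume "e > 0"
    obtain N :: nat where N: "2 * B / e < real N"
      using reals_Archimedean2 by blast
    show "\<forall>\<^sub>F K in sequentially. \<forall>s\<in>{1..}. dist (\<Sum>k<K. \<psi> (Suc k) * real (Suc k) powr (-s)) (lseries \<psi> s) < e"
      using eventually_ge_at_top[of N]
    proof (eventually_elim, intro ballI)
      fix K s assume "N \<le> K" "s \<in> {1::real..}"
      have "2 * B / e < real (Suc K)" using N \<open>N \<le> K\<close> by linarith
      then have "2 * B / real (Suc K) < e" using \<open>e > 0\<close> by (simp add: field_simps del: of_nat_Suc)
      with lseries_tail_bound[of s K] \<open>s \<in> {1..}\<close>
      show "dist (\<Sum>k<K. \<psi> (Suc k) * real (Suc k) powr (-s)) (lseries \<psi> s) < e"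
        by (simp add: dist_real_def)
    qed
  qed
  show "\<forall>\<^sub>F K in sequentially. continuous_on {1..} (\<lambda>s. \<Sum>k<K. \<psi> (Suc k) * real (Suc k) powr (-s))"
    by (intro always_eventually allI continuous_intros) auto
qed simp

text \<open>If \<open>L(1,\<psi>)\<close> vanished, the Lambert series \<open>\<Sum> \<psi>(n) x\<^sup>n / (1 - x\<^sup>n)\<close> would stay bounded as
  \<open>x\<close> tends to 1; but its power series coefficients are nonnegative, and at least 1 at squares.\<close>

lemma lseries_1_nonzero: "lseries \<psi> 1 \<noteq> 0"
proof
  assume L0: "lseries \<psi> 1 = 0"
  \<comment> \<open>Afterwards \<open>y\<close> tends to 1 with \<open>K\<close> fixed, giving
    \<open>real K \<le> B\<close>, which fails for large \<open>K\<close>.\<close>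
  have bound: "real K * (y\<^sup>2) ^ (K\<^sup>2) \<le> B" if y: "0 < y" "y < 1" for K and y :: real
  proof -
    define x where "x = y\<^sup>2"
    have x: "0 < x" "x < 1"
      using y by (simp_all add: x_def power_less_one_iff)
    have le: "real K * x ^ (K\<^sup>2) \<le> B + 2 * B / real (Suc R) / (1 - x) + real R * x ^ R / (1 - x)"
      if R: "R \<ge> K\<^sup>2" for R
    proof -
      have "\<bar>\<Sum>k<R. \<psi> (Suc k) * lambert_weight x k\<bar> \<le> B * lambert_weight x 0"
        unfolding x_def using lambert_weight_monotone[OF y] by (intro abel_summation_bound partial_sums) auto
      then have 1: "\<bar>\<Sum>k<R. \<psi> (Suc k) * lambert_weight x k\<bar> \<le> B"
        using lambert_weight_monotone(3)[OF y] by (simp add: x_def)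
      \<comment> \<open>Here the assumption \<open>lseries \<psi> 1 = 0\<close> enters: partial sums
        at 1 become as small as tails.\<close>
      have 2: "\<bar>\<Sum>k<R. \<psi> (Suc k) * real (Suc k) powr (-1)\<bar> \<le> 2 * B / real (Suc R)"
        using lseries_tail_bound[of 1 R] L0 by simp
      have "(\<Sum>n=1..R. \<psi> n * (x ^ n / (1 - x ^ n))) = (\<Sum>k<R. \<psi> (Suc k) * (x ^ Suc k / (1 - x ^ Suc k)))"
        by (rule sum.reindex_bij_witness[of _ Suc "\<lambda>n. n - 1"]) auto
      \<comment> \<open>Each quotient is \<open>1 / (n * (1 - x))\<close> minus its weight; the
        first part is small by fact \<open>2\<close>, the second bounded by fact
        \<open>1\<close>.\<close>
      also have "\<dots> = (\<Sum>k<R. \<psi> (Suc k) * real (Suc k) powr (-1) / (1 - x) - \<psi> (Suc k) * lambert_weight x k)"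
        unfolding lambert_weight_def
        by (intro sum.cong) (auto simp: powr_minus_divide right_diff_distrib simp del: of_nat_Suc power_Suc)
      also have "\<dots> = (\<Sum>k<R. \<psi> (Suc k) * real (Suc k) powr (-1)) / (1 - x) - (\<Sum>k<R. \<psi> (Suc k) * lambert_weight x k)"
        by (simp add: sum_subtractf sum_divide_distrib)
      also have "\<dots> \<le> 2 * B / real (Suc R) / (1 - x) + B"
      proof -
        have "(\<Sum>k<R. \<psi> (Suc k) * real (Suc k) powr (-1)) / (1 - x) \<le> 2 * B / real (Suc R) / (1 - x)"
          using 2 x by (intro divide_right_mono) auto
        then show ?thesis using 1 by linarith
      qed
      finally show ?thesis
        using lambert_partial_sum_ge[OF char x R] by linarith
    qed
    have "(\<lambda>R. real R * x ^ R) \<longlonglongrightarrow> 0"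
      using x powser_times_n_limit_0[of x] by simp
    moreover have "(\<lambda>R. 2 * B / real (Suc R)) \<longlonglongrightarrow> 0"
      by (rule LIMSEQ_Suc[OF lim_const_over_n])
    ultimately have "(\<lambda>R. B + 2 * B / real (Suc R) / (1 - x) + real R * x ^ R / (1 - x)) \<longlonglongrightarrow> B + 0 / (1 - x) + 0 / (1 - x)"
      using x by (intro tendsto_intros) auto
    then have "(\<lambda>R. B + 2 * B / real (Suc R) / (1 - x) + real R * x ^ R / (1 - x)) \<longlonglongrightarrow> B"
      by simp
    then show ?thesis
      unfolding x_def[symmetric] using le by (intro LIMSEQ_le_const) auto
  qed
  obtain K :: nat where K: "B < real K"
    using reals_Archimedean2 by blast
  have "((\<lambda>y. real K * (y\<^sup>2) ^ (K\<^sup>2)) \<longlongrightarrow> real K * (1\<^sup>2) ^ (K\<^sup>2)) (at_left (1::real))"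
    by (intro tendsto_intros)
  moreover have "\<forall>\<^sub>F y in at_left (1::real). real K * (y\<^sup>2) ^ (K\<^sup>2) \<le> B"
    using eventually_at_left_real[OF zero_less_one] by eventually_elim (auto intro: bound)
  ultimately have "real K * (1\<^sup>2) ^ (K\<^sup>2) \<le> B"
    by (rule tendsto_upperbound) simp
  then show False using K by simp
qed

end

section \<open>Euler products and sums over primes\<close>

lemma prime_sum_inverse_squares_le: "(\<Sum>p | prime p \<and> p < P. 1 / (real p)\<^sup>2) \<le> 1"
proof -
  have partial: "(\<Sum>n<N. 1 / (real (n + 2))\<^sup>2) \<le> 1 - 1 / real (Suc N)" for N
  proof (induction N)
    case (Suc N)
    have "1 / (real (N + 2))\<^sup>2 \<le> 1 / (real (Suc N) * real (N + 2))"
      by (simp add: power2_eq_square frac_le)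
    also have "\<dots> = 1 / real (Suc N) - 1 / real (Suc (Suc N))"
      by (simp add: field_simps)
    finally show ?case using Suc by simp
  qed simp
  have "(\<Sum>p | prime p \<and> p < P. 1 / (real p)\<^sup>2) \<le> (\<Sum>n\<in>(\<lambda>n. n + 2) ` {..<P}. 1 / (real n)\<^sup>2)"
  proof (rule sum_mono2)
    show "{p. prime p \<and> p < P} \<subseteq> (\<lambda>n. n + 2) ` {..<P}"
    proof
      fix p assume "p \<in> {p. prime p \<and> p < P}"
      then show "p \<in> (\<lambda>n. n + 2) ` {..<P}"
        using prime_ge_2_nat[of p] by (intro image_eqI[of _ _ "p - 2"]) auto
    qed
  qed auto
  also have "\<dots> = (\<Sum>n<P. 1 / (real (n + 2))\<^sup>2)"
    by (subst sum.reindex) (auto simp: inj_on_def)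
  also have "\<dots> \<le> 1"
    using partial[of P] by (smt (verit) divide_nonneg_nonneg of_nat_0_le_iff)
  finally show ?thesis .
qed

context
  fixes M :: nat and \<psi> :: "nat \<Rightarrow> real" and s :: real
  assumes char: "real_character M \<psi>" and s: "s > 1"
begin

definition euler_term :: "nat \<Rightarrow> real" where
  "euler_term n = \<psi> n * real n powr (-s)"

text \<open>The survivors of sieving by the primes below \<open>P\<close>. For
  \<open>P \<le> 2\<close> they include 0, which is harmless since
  \<open>euler_term 0 = 0\<close>.\<close>

definition rough_numbers :: "nat \<Rightarrow> nat set" where
  "rough_numbers P = {n. \<forall>p<P. prime p \<longrightarrow> \<not> p dvd n}"

lemma euler_term_mult: "euler_term (m * n) = euler_term m * euler_term n"
  by (simp add: euler_term_def character_mult[OF char] powr_mult)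

lemma euler_term_0: "euler_term 0 = 0" and euler_term_1: "euler_term (Suc 0) = 1"
  by (simp_all add: euler_term_def character_1[OF char])

lemma abs_euler_term_le: "\<bar>euler_term n\<bar> \<le> real n powr (-s)"
  using mult_right_mono[OF character_abs_le[OF char, of n], of "real n powr (-s)"]
  by (simp add: euler_term_def abs_mult)

lemma abs_euler_term_prime_le: "prime p \<Longrightarrow> \<bar>euler_term p\<bar> \<le> 1 / real p"
proof -
  assume "prime p"
  then have "real p \<ge> 1" using prime_ge_1_nat[of p] by simp
  then have "real p powr (-s) \<le> real p powr (-1)" using s by (intro powr_mono) auto
  then show ?thesis using abs_euler_term_le[of p] \<open>real p \<ge> 1\<close> by (simp add: powr_minus_divide)
qed

lemma abs_euler_term_prime_le_half:
  assumes "prime p"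
  shows "\<bar>euler_term p\<bar> \<le> 1 / 2"
proof -
  have "real p \<ge> 2"
    using prime_ge_2_nat[OF assms] by simp
  then have "1 / real p \<le> 1 / 2"
    by (simp add: field_simps)
  with abs_euler_term_prime_le[OF assms] show ?thesis by linarith
qed

lemma euler_term_abs_summable: "summable (\<lambda>n. \<bar>euler_term n\<bar>)"
proof (rule summable_comparison_test'[of _ 0])
  show "summable (\<lambda>n. real n powr (-s))"
    using s by (simp add: summable_real_powr_iff)
qed (use abs_euler_term_le in auto)

lemma euler_term_summable_on: "(\<lambda>n. \<bar>euler_term n\<bar>) summable_on A" "euler_term summable_on A"
proof -
  have "(\<lambda>n. norm (euler_term n)) summable_on UNIV"
    using euler_term_abs_summable by (intro norm_summable_imp_summable_on) simp
  then have *: "(\<lambda>n. norm (euler_term n)) summable_on A"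
    by (rule summable_on_subset_banach) simp
  then show "(\<lambda>n. \<bar>euler_term n\<bar>) summable_on A" by simp
  from * show "euler_term summable_on A" by (rule abs_summable_summable)
qed

lemma infsum_euler_term: "infsum euler_term UNIV = lseries \<psi> s"
proof -
  have "summable euler_term"
    using euler_term_abs_summable summable_rabs_cancel by blast
  have "(euler_term has_sum infsum euler_term UNIV) UNIV"
    by (rule has_sum_infsum[OF euler_term_summable_on(2)])
  then have "euler_term sums infsum euler_term UNIV"
    by (rule has_sum_imp_sums)
  then have "infsum euler_term UNIV = suminf euler_term"
    by (simp add: sums_iff)
  also have "\<dots> = (\<Sum>n. euler_term (Suc n))"
    using suminf_split_head[OF \<open>summable euler_term\<close>] by (simp add: euler_term_0)
  finally show ?thesis by (simp add: lseries_def euler_term_def)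
qed

text \<open>A finite form of the Euler product: sieving by a further prime \<open>P\<close> removes
  the multiples of \<open>P\<close>, whose sum is \<open>euler_term P\<close> times the previous
  sum.\<close>

lemma euler_product_sieve:
  "(\<Prod>p | prime p \<and> p < P. 1 - euler_term p) * lseries \<psi> s = infsum euler_term (rough_numbers P)"
proof (induction P)
  case 0
  have "rough_numbers 0 = UNIV" by (simp add: rough_numbers_def)
  then show ?case by (simp add: infsum_euler_term)
next
  case (Suc P)
  show ?case
  proof (cases "prime P")
    case False
    then have "{p. prime p \<and> p < Suc P} = {p. prime p \<and> p < P}" "rough_numbers (Suc P) = rough_numbers P"
      by (auto simp: less_Suc_eq rough_numbers_def)
    then show ?thesis using Suc by simp
  next
    case True
    define A where "A = rough_numbers P"
    have eq: "{p. prime p \<and> p < Suc P} = insert P {p. prime p \<and> p < P}"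
      using True by (auto simp: less_Suc_eq)
    have "(\<lambda>m. P * m) ` A = {n \<in> A. P dvd n}"
    proof (intro equalityI subsetI)
      fix n assume "n \<in> (\<lambda>m. P * m) ` A"
      then obtain m where m: "m \<in> A" "n = P * m" by blast
      have "\<not> p dvd n" if p: "p < P" "prime p" for p
      proof
        assume "p dvd n"
        then have "p dvd P \<or> p dvd m" using p m by (simp add: prime_dvd_mult_iff)
        then show False
          using primes_dvd_imp_eq[OF p(2) True] p m by (auto simp: A_def rough_numbers_def)
      qed
      then show "n \<in> {n \<in> A. P dvd n}" using m by (simp add: A_def rough_numbers_def)
    next
      fix n assume "n \<in> {n \<in> A. P dvd n}"
      then obtain m where m: "n \<in> A" "n = P * m" by blast
      have "\<not> q dvd m" if "q < P" "prime q" for q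
        using that m dvd_mult[of q m P] unfolding A_def rough_numbers_def by blast
      then have "m \<in> A" unfolding A_def rough_numbers_def by blast
      then show "n \<in> (\<lambda>m. P * m) ` A" using m by blast
    qed
    moreover have "rough_numbers (Suc P) = {n \<in> A. \<not> P dvd n}"
      using True by (auto simp: A_def rough_numbers_def less_Suc_eq)
    ultimately have split: "A = rough_numbers (Suc P) \<union> (\<lambda>m. P * m) ` A" "rough_numbers (Suc P) \<inter> (\<lambda>m. P * m) ` A = {}"
      by blast+
    have "infsum euler_term A = infsum euler_term (rough_numbers (Suc P)) + infsum euler_term ((\<lambda>m. P * m) ` A)"
      by (subst split(1), rule infsum_Un_disjoint[OF euler_term_summable_on(2) euler_term_summable_on(2) split(2)])
    also have "infsum euler_term ((\<lambda>m. P * m) ` A) = infsum (euler_term \<circ> (\<lambda>m. P * m)) A"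
      using True by (intro infsum_reindex) (auto simp: inj_on_def)
    also have "\<dots> = euler_term P * infsum euler_term A"
      by (simp add: o_def euler_term_mult infsum_cmult_right')
    finally have "infsum euler_term (rough_numbers (Suc P)) = (1 - euler_term P) * infsum euler_term A"
      unfolding left_diff_distrib by linarith
    moreover have "(\<Prod>p | prime p \<and> p < Suc P. 1 - euler_term p) = (1 - euler_term P) * (\<Prod>p | prime p \<and> p < P. 1 - euler_term p)"
      unfolding eq by (subst prod.insert) auto
    ultimately show ?thesis
      using Suc unfolding A_def by (simp only: mult.assoc)
  qed
qed

text \<open>For \<open>P > 2\<close> all survivors except 1 are at least \<open>P\<close>, so they
  form part of the tail of an absolutely convergent series.\<close>

lemma rough_sum_tendsto: "(\<lambda>P. infsum euler_term (rough_numbers P)) \<longlonglongrightarrow> 1"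
proof -
  define g where "g n = \<bar>euler_term n\<bar>" for n
  have g_sums: "(\<lambda>P. \<Sum>n<P. g n) \<longlonglongrightarrow> infsum g UNIV"
  proof -
    have "(g has_sum infsum g UNIV) UNIV"
      unfolding g_def by (rule has_sum_infsum[OF euler_term_summable_on(1)])
    then have "g sums infsum g UNIV" by (rule has_sum_imp_sums)
    then show ?thesis by (simp add: sums_def)
  qed
  have tail: "infsum g {P..} = infsum g UNIV - (\<Sum>n<P. g n)" for P
  proof -
    have "infsum g ({..<P} \<union> {P..}) = infsum g {..<P} + infsum g {P..}"
      unfolding g_def by (intro infsum_Un_disjoint euler_term_summable_on) auto
    moreover have "{..<P} \<union> {P..} = UNIV" by auto
    ultimately show ?thesis by simp
  qed
  have "(\<lambda>P. infsum g UNIV - (\<Sum>n<P. g n)) \<longlonglongrightarrow> infsum g UNIV - infsum g UNIV"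
    by (intro tendsto_intros g_sums)
  then have lim0: "(\<lambda>P. infsum g {P..}) \<longlonglongrightarrow> 0"
    by (simp add: tail)
  have bound: "norm (infsum euler_term (rough_numbers P) - 1) \<le> infsum g {P..}" if "P > 2" for P
  proof -
    have one: "Suc 0 \<in> rough_numbers P"
      by (auto simp: rough_numbers_def)
    have "infsum euler_term (rough_numbers P) = infsum euler_term ({Suc 0} \<union> (rough_numbers P - {Suc 0}))"
      using one by (simp add: insert_absorb)
    also have "\<dots> = infsum euler_term {Suc 0} + infsum euler_term (rough_numbers P - {Suc 0})"
      by (intro infsum_Un_disjoint euler_term_summable_on) auto
    finally have "norm (infsum euler_term (rough_numbers P) - 1) = norm (infsum euler_term (rough_numbers P - {Suc 0}))"
      by (simp add: euler_term_1)
    also have "\<dots> \<le> infsum (\<lambda>n. norm (euler_term n)) (rough_numbers P - {Suc 0})"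
      using euler_term_summable_on(1) by (intro norm_infsum_bound) simp
    also have "\<dots> = infsum g (rough_numbers P - {Suc 0})"
      by (simp add: g_def[abs_def])
    also have "\<dots> \<le> infsum g {P..}"
    proof (rule infsum_mono2)
      show "rough_numbers P - {Suc 0} \<subseteq> {P..}"
      proof
        fix n assume n: "n \<in> rough_numbers P - {Suc 0}"
        then obtain p where p: "prime p" "p dvd n" using prime_factor_nat[of n] by auto
        then have "\<not> p < P" using n unfolding rough_numbers_def by blast
        moreover have "n \<noteq> 0"
        proof
          assume "n = 0"
          then have "\<not> 2 dvd (0::nat)"
            using n \<open>P > 2\<close> two_is_prime_nat unfolding rough_numbers_def by blast
          then show False by simp
        qed
        then have "p \<le> n" using p by (simp add: dvd_imp_le)
        ultimately show "n \<in> {P..}" by simp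
      qed
    qed (use euler_term_summable_on(1) in \<open>auto simp: g_def[abs_def]\<close>)
    finally show ?thesis .
  qed
  have "\<forall>\<^sub>F P in sequentially. norm (infsum euler_term (rough_numbers P) - 1) \<le> infsum g {P..}"
    using eventually_gt_at_top[of 2] by eventually_elim (rule bound)
  then have "(\<lambda>P. infsum euler_term (rough_numbers P) - 1) \<longlonglongrightarrow> 0"
    using lim0 by (rule Lim_null_comparison)
  then show ?thesis by (simp add: LIM_zero_iff)
qed

lemma euler_product_pos: "(\<Prod>p | prime p \<and> p < P. 1 - euler_term p) > 0"
proof (rule prod_pos)
  fix p assume "p \<in> {p. prime p \<and> p < P}"
  then show "0 < 1 - euler_term p" using abs_euler_term_prime_le_half[of p] by auto
qed

text \<open>The Euler factors are positive, so a value at most 0 would keep the sieved sums at most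
  0, although they tend to 1.\<close>

lemma lseries_pos: "lseries \<psi> s > 0"
proof (rule ccontr)
  assume "\<not> lseries \<psi> s > 0"
  then have "infsum euler_term (rough_numbers P) \<le> 0" for P
    unfolding euler_product_sieve[symmetric] using euler_product_pos[of P] by (simp add: mult_le_0_iff)
  then have "(1::real) \<le> 0"
    using rough_sum_tendsto by (intro LIMSEQ_le_const2) auto
  then show False by simp
qed

text \<open>Logarithm of the sieve identity. The error consists of 1 for the sieved sum, which is
  near 1, and 2 for the quadratic errors of \<open>ln\<close>. That it is independent of
  \<open>s\<close> allows \<open>s\<close> to be taken close to 1 later.\<close>

lemma prime_sum_log_approx:
  "\<forall>\<^sub>F P in sequentially. \<bar>(\<Sum>p | prime p \<and> p < P. \<psi> p * real p powr (-s)) - ln (lseries \<psi> s)\<bar> \<le> 3"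
proof -
  define Q where "Q P = {p. prime p \<and> p < P}" for P :: nat
  have "(\<lambda>P. ln (infsum euler_term (rough_numbers P))) \<longlonglongrightarrow> ln 1"
    by (intro tendsto_ln rough_sum_tendsto) simp
  then have "\<forall>\<^sub>F P in sequentially. \<bar>ln (infsum euler_term (rough_numbers P))\<bar> < 1"
    by (auto dest!: tendstoD[where e = 1] simp: dist_real_def)
  then show ?thesis
  proof eventually_elim
    case (elim P)
    have "ln (infsum euler_term (rough_numbers P)) = ln (\<Prod>p\<in>Q P. 1 - euler_term p) + ln (lseries \<psi> s)"
      unfolding euler_product_sieve[symmetric] Q_def using euler_product_pos[of P] lseries_pos by (intro ln_mult_pos)
    also have "ln (\<Prod>p\<in>Q P. 1 - euler_term p) = (\<Sum>p\<in>Q P. ln (1 - euler_term p))"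
    proof (rule ln_prod)
      fix p assume "p \<in> Q P"
      then show "1 - euler_term p \<noteq> 0" using abs_euler_term_prime_le_half[of p] by (auto simp: Q_def)
    qed (simp add: Q_def)
    finally have 1: "\<bar>(\<Sum>p\<in>Q P. ln (1 - euler_term p)) + ln (lseries \<psi> s)\<bar> < 1"
      using elim by simp
    have "\<bar>(\<Sum>p\<in>Q P. ln (1 - euler_term p)) + (\<Sum>p\<in>Q P. euler_term p)\<bar> = \<bar>\<Sum>p\<in>Q P. ln (1 - euler_term p) + euler_term p\<bar>"
      by (simp add: sum.distrib)
    also have "\<dots> \<le> (\<Sum>p\<in>Q P. \<bar>ln (1 - euler_term p) + euler_term p\<bar>)"
      by (rule sum_abs)
    also have "\<dots> \<le> (\<Sum>p\<in>Q P. 2 * (1 / (real p)\<^sup>2))"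
    proof (rule sum_mono)
      fix p assume "p \<in> Q P"
      then have p: "prime p" by (simp add: Q_def)
      have "\<bar>ln (1 + - euler_term p) - - euler_term p\<bar> \<le> 2 * (- euler_term p)\<^sup>2"
        using abs_euler_term_prime_le_half[OF p] by (intro abs_ln_one_plus_x_minus_x_bound) simp
      also have "(- euler_term p)\<^sup>2 \<le> (1 / real p)\<^sup>2"
        using abs_euler_term_prime_le[OF p] power_mono[of "\<bar>euler_term p\<bar>" "1 / real p" 2] by simp
      finally show "\<bar>ln (1 - euler_term p) + euler_term p\<bar> \<le> 2 * (1 / (real p)\<^sup>2)"
        by (simp add: power_divide)
    qed
    also have "\<dots> = 2 * (\<Sum>p\<in>Q P. 1 / (real p)\<^sup>2)"
      by (simp only: sum_distrib_left)
    also have "\<dots> \<le> 2"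
      using prime_sum_inverse_squares_le[of P] by (simp add: Q_def)
    finally show ?case
      using 1 unfolding Q_def euler_term_def by linarith
  qed
qed

end

section \<open>Existence of primes with prescribed character values\<close>

lemma real_character_prod:
  assumes "finite D" "\<And>i. i \<in> D \<Longrightarrow> real_character M (\<psi> i)"
  shows "real_character M (\<lambda>n. \<Prod>i\<in>D. \<psi> i n)"
  using assms
proof (induction D rule: finite_induct)
  case empty
  show ?case by (simp add: real_character_def)
next
  case (insert i D)
  have 1: "real_character M (\<psi> i)" and 2: "real_character M (\<lambda>n. \<Prod>i\<in>D. \<psi> i n)"
    using insert by auto
  have "\<psi> i n * (\<Prod>i\<in>D. \<psi> i n) \<in> {-1, 0, 1}" for n
    using character_cases[OF 1, of n] character_cases[OF 2, of n] by auto
  moreover have "\<psi> i (n + M) * (\<Prod>i\<in>D. \<psi> i (n + M)) = \<psi> i n * (\<Prod>i\<in>D. \<psi> i n)" for n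
    using 1 2 unfolding real_character_def by metis
  moreover have "\<psi> i (m * n) * (\<Prod>i\<in>D. \<psi> i (m * n)) = (\<psi> i m * (\<Prod>i\<in>D. \<psi> i m)) * (\<psi> i n * (\<Prod>i\<in>D. \<psi> i n))" for m n
    using character_mult[OF 1, of m n] character_mult[OF 2, of m n] by simp
  moreover have "\<psi> i 1 * (\<Prod>i\<in>D. \<psi> i 1) = 1"
    using character_1(1)[OF 1] character_1(1)[OF 2] by simp
  ultimately show ?case
    using insert.hyps unfolding real_character_def by simp
qed

text \<open>Divergence of the zeta function at 1: a finite partial sum tends to a harmonic number,
  and these are unbounded.\<close>

lemma lseries_one_at_top: "\<forall>\<^sub>F s in at_right 1. lseries (\<lambda>_. 1) s > C"
proof -
  obtain N where N: "harm N > C + 1"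
    using filterlim_at_top_dense[of "harm :: nat \<Rightarrow> real" sequentially] harm_at_top
    by (metis (no_types, lifting) eventually_happens' sequentially_bot)
  have "((\<lambda>s. \<Sum>k<N. real (Suc k) powr (-s)) \<longlongrightarrow> (\<Sum>k<N. real (Suc k) powr (-1))) (at_right 1)"
    by (intro tendsto_intros) auto
  moreover have "(\<Sum>k<N. real (Suc k) powr (-1)) = harm N"
    by (simp add: harm_altdef powr_minus powr_one)
  ultimately have "\<forall>\<^sub>F s in at_right 1. (\<Sum>k<N. real (Suc k) powr (-s)) > C"
    using N by (intro order_tendstoD(1)) auto
  then show ?thesis
    using eventually_at_right_less[of "1::real"]
  proof eventually_elim
    case (elim s)
    have "summable (\<lambda>n. real n powr (-s))"
      using elim by (simp add: summable_real_powr_iff)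
    then have "summable (\<lambda>n. real (Suc n) powr (-s))"
      by (subst summable_Suc_iff)
    then have "(\<Sum>k<N. real (Suc k) powr (-s)) \<le> (\<Sum>k. real (Suc k) powr (-s))"
      by (intro sum_le_suminf) auto
    with elim show ?case by (simp add: lseries_def)
  qed
qed

text \<open>The value at 1 is nonzero and a limit of positive numbers, hence positive; so the
  logarithm stays bounded near 1.\<close>

lemma log_lseries_bounded:
  assumes "real_character M \<psi>" "M > 0" "coprime c M" "\<psi> c = -1"
  obtains C where "\<forall>\<^sub>F s in at_right 1. \<bar>ln (lseries \<psi> s)\<bar> \<le> C"
proof -
  have bound: "\<bar>\<Sum>k<n. \<psi> (Suc k)\<bar> \<le> real M + 1" for n
    using character_partial_sums_bounded[OF assms(1) character_sum_eq_0[OF assms(1,3,4)] assms(2)] .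
  have "continuous_on {1..} (lseries \<psi>)"
    by (rule lseries_continuous_on[OF assms(1) bound])
  then have "(lseries \<psi> \<longlongrightarrow> lseries \<psi> 1) (at 1 within {1..})"
    by (simp add: continuous_on_def)
  then have lim: "(lseries \<psi> \<longlongrightarrow> lseries \<psi> 1) (at_right 1)"
    by (rule tendsto_within_subset) auto
  have "\<forall>\<^sub>F s in at_right 1. 0 \<le> lseries \<psi> s"
    using eventually_at_right_less[of "1::real"]
    by eventually_elim (auto intro: less_imp_le lseries_pos[OF assms(1)])
  with lim have "0 \<le> lseries \<psi> 1"
    by (rule tendsto_lowerbound) simp
  moreover have "lseries \<psi> 1 \<noteq> 0"
    by (rule lseries_1_nonzero[OF assms(1) bound])
  ultimately have pos: "lseries \<psi> 1 > 0" by simp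
  have "((\<lambda>s. \<bar>ln (lseries \<psi> s)\<bar>) \<longlongrightarrow> \<bar>ln (lseries \<psi> 1)\<bar>) (at_right 1)"
    using pos by (intro tendsto_intros lim) auto
  then have "\<forall>\<^sub>F s in at_right 1. \<bar>ln (lseries \<psi> s)\<bar> < \<bar>ln (lseries \<psi> 1)\<bar> + 1"
    by (rule order_tendstoD) simp
  then show ?thesis
    by (intro that[of "\<bar>ln (lseries \<psi> 1)\<bar> + 1"]) (auto elim: eventually_mono)
qed

text \<open>The product of the factors \<open>\<epsilon> i * \<psi> i p + 1\<close> vanishes at each
  prime outside \<open>M\<close> that violates a prescription. Expanded over subsets of
  \<open>I\<close>, the empty subset contributes the divergent sum belonging to zeta. Every other
  subset contributes a bounded one, since \<open>indep\<close> makes its product character take the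
  value -1.\<close>

theorem prime_with_prescribed_characters:
  fixes I :: "'i set" and \<psi> :: "'i \<Rightarrow> nat \<Rightarrow> real" and \<epsilon> :: "'i \<Rightarrow> real"
  assumes I: "finite I" and M: "M > 0"
    and char: "\<And>i. i \<in> I \<Longrightarrow> real_character M (\<psi> i)"
    and nonzero: "\<And>i n. i \<in> I \<Longrightarrow> coprime n M \<Longrightarrow> \<psi> i n \<noteq> 0"
    and indep: "\<And>i. i \<in> I \<Longrightarrow> \<exists>c. coprime c M \<and> \<psi> i c = -1 \<and> (\<forall>j\<in>I - {i}. \<psi> j c = 1)"
    and \<epsilon>: "\<And>i. i \<in> I \<Longrightarrow> \<epsilon> i = 1 \<or> \<epsilon> i = -1"
  shows "\<exists>q. prime q \<and> coprime q M \<and> (\<forall>i\<in>I. \<psi> i q = \<epsilon> i)"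
proof (rule ccontr)
  assume contr: "\<not> ?thesis"
  define X where "X D n = (\<Prod>i\<in>D. \<psi> i n)" for D n
  define e where "e D = (\<Prod>i\<in>D. \<epsilon> i)" for D
  define S where "S D P s = (\<Sum>p | prime p \<and> p < P. X D p * real p powr (-s))" for D and P :: nat and s :: real
  define J where "J = Pow I - {{}}"
  have J: "finite J" using I by (simp add: J_def)
  have charX: "real_character M (X D)" if "D \<subseteq> I" for D
    unfolding X_def using that I char by (intro real_character_prod) (auto intro: finite_subset)
  have abs_e: "\<bar>e D\<bar> = 1" if "D \<subseteq> I" for D
  proof -
    have "\<bar>e D\<bar> = (\<Prod>i\<in>D. \<bar>\<epsilon> i\<bar>)" by (simp add: e_def abs_prod)
    also have "\<dots> = 1" using \<epsilon> that by (intro prod.neutral) force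
    finally show ?thesis .
  qed
  have "\<exists>C. \<forall>\<^sub>F s in at_right 1. \<bar>ln (lseries (X D) s)\<bar> \<le> C" if D: "D \<in> J" for D
  proof -
    obtain i where i: "i \<in> D" "D \<subseteq> I" using D by (auto simp: J_def)
    then obtain c where c: "coprime c M" "\<psi> i c = -1" "\<forall>j\<in>I - {i}. \<psi> j c = 1"
      using indep[of i] by blast
    have "X D c = \<psi> i c * (\<Prod>j\<in>D - {i}. \<psi> j c)"
      unfolding X_def using i I by (intro prod.remove) (auto intro: finite_subset)
    also have "(\<Prod>j\<in>D - {i}. \<psi> j c) = 1"
      using c i by (intro prod.neutral) auto
    finally have "X D c = -1" using c by simp
    then show ?thesis
      using log_lseries_bounded[OF charX[OF i(2)] M c(1)] by blast
  qed
  then obtain C where C: "\<And>D. D \<in> J \<Longrightarrow> \<forall>\<^sub>F s in at_right 1. \<bar>ln (lseries (X D) s)\<bar> \<le> C D"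
    by metis
  \<comment> \<open>The summands account for primes dividing \<open>M\<close>, for the nonempty
    subsets, and for the approximation error at the empty subset.\<close>
  define K where "K = real M * 2 ^ card I + (\<Sum>D\<in>J. C D + 3) + 3"
  have "\<forall>\<^sub>F s in at_right 1. \<forall>D\<in>J. \<bar>ln (lseries (X D) s)\<bar> \<le> C D"
    using J C by (intro eventually_ball_finite) auto
  moreover have "\<forall>\<^sub>F s in at_right 1. lseries (X {}) s > exp K"
    using lseries_one_at_top[of "exp K"] by (simp add: X_def[abs_def])
  moreover have "\<forall>\<^sub>F s in at_right (1::real). s > 1"
    by (rule eventually_at_right_less)
  ultimately have "\<forall>\<^sub>F s in at_right 1. (\<forall>D\<in>J. \<bar>ln (lseries (X D) s)\<bar> \<le> C D) \<and> lseries (X {}) s > exp K \<and> s > 1"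
    by eventually_elim auto
  then obtain s where sC: "\<And>D. D \<in> J \<Longrightarrow> \<bar>ln (lseries (X D) s)\<bar> \<le> C D"
    and sK: "lseries (X {}) s > exp K" and s: "s > 1"
    using eventually_happens'[OF trivial_limit_at_right_real[of 1]] by blast
  have "\<forall>\<^sub>F P in sequentially. \<forall>D\<in>Pow I. \<bar>S D P s - ln (lseries (X D) s)\<bar> \<le> 3"
    unfolding S_def using I s charX by (intro eventually_ball_finite ballI prime_sum_log_approx) auto
  then obtain P where P: "\<And>D. D \<subseteq> I \<Longrightarrow> \<bar>S D P s - ln (lseries (X D) s)\<bar> \<le> 3"
    using eventually_happens'[OF sequentially_bot] by blast
  have expand: "(\<Sum>p | prime p \<and> p < P. (\<Prod>i\<in>I. \<epsilon> i * \<psi> i p + 1) * real p powr (-s)) = (\<Sum>D\<in>Pow I. e D * S D P s)"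
  proof -
    have "(\<Prod>i\<in>I. \<epsilon> i * \<psi> i p + 1) = (\<Sum>D\<in>Pow I. e D * X D p)" for p
      using prod_add[OF I, of "\<lambda>i. \<epsilon> i * \<psi> i p" "\<lambda>_. 1"] by (simp add: e_def X_def prod.distrib)
    then have "(\<Sum>p | prime p \<and> p < P. (\<Prod>i\<in>I. \<epsilon> i * \<psi> i p + 1) * real p powr (-s))
        = (\<Sum>p | prime p \<and> p < P. \<Sum>D\<in>Pow I. e D * (X D p * real p powr (-s)))"
      by (simp add: sum_distrib_right mult.assoc)
    also have "\<dots> = (\<Sum>D\<in>Pow I. \<Sum>p | prime p \<and> p < P. e D * (X D p * real p powr (-s)))"
      by (rule sum.swap)
    finally show ?thesis by (simp add: S_def sum_distrib_left)
  qed
  have "(\<Sum>p | prime p \<and> p < P. (\<Prod>i\<in>I. \<epsilon> i * \<psi> i p + 1) * real p powr (-s))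
      \<le> (\<Sum>p | prime p \<and> p < P. if p dvd M then 2 ^ card I else 0)"
  proof (rule sum_mono)
    fix p assume "p \<in> {p. prime p \<and> p < P}"
    then have p: "prime p" by simp
    show "(\<Prod>i\<in>I. \<epsilon> i * \<psi> i p + 1) * real p powr (-s) \<le> (if p dvd M then 2 ^ card I else 0)"
    proof (cases "p dvd M")
      case True
      have bounds: "0 \<le> \<epsilon> i * \<psi> i p + 1 \<and> \<epsilon> i * \<psi> i p + 1 \<le> 2" if "i \<in> I" for i
        using character_cases[OF char[OF that], of p] \<epsilon>[OF that] by auto
      then have "(\<Prod>i\<in>I. \<epsilon> i * \<psi> i p + 1) \<le> (\<Prod>i\<in>I. 2)"
        by (intro prod_mono) auto
      moreover have "real p powr (-s) \<le> 1"
        using s prime_ge_1_nat[OF p] powr_mono[of "-s" 0 "real p"] by simp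
      moreover have "0 \<le> (\<Prod>i\<in>I. \<epsilon> i * \<psi> i p + 1)"
        using bounds by (intro prod_nonneg) auto
      ultimately have "(\<Prod>i\<in>I. \<epsilon> i * \<psi> i p + 1) * real p powr (-s) \<le> 2 ^ card I * 1"
        by (intro mult_mono) auto
      then show ?thesis using True by simp
    next
      case False
      then have "coprime p M" using p by (simp add: prime_imp_coprime)
      then obtain i where i: "i \<in> I" "\<psi> i p \<noteq> \<epsilon> i" using contr p by blast
      then have "\<epsilon> i * \<psi> i p + 1 = 0"
        using nonzero[OF i(1) \<open>coprime p M\<close>] character_cases[OF char[OF i(1)], of p] \<epsilon>[OF i(1)] by auto
      then have "(\<Prod>i\<in>I. \<epsilon> i * \<psi> i p + 1) = 0"
        using I i(1) by (intro prod_zero) auto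
      then show ?thesis using False by simp
    qed
  qed
  also have "\<dots> = (\<Sum>p | (prime p \<and> p < P) \<and> p dvd M. 2 ^ card I)"
    by (simp add: sum.inter_filter[symmetric])
  also have "\<dots> = real (card {p. (prime p \<and> p < P) \<and> p dvd M}) * 2 ^ card I"
    by simp
  also have "\<dots> \<le> real M * 2 ^ card I"
  proof -
    have "{p. (prime p \<and> p < P) \<and> p dvd M} \<subseteq> {1..M}"
      using M by (auto simp: dvd_imp_le Suc_le_eq prime_gt_0_nat)
    from card_mono[OF _ this] show ?thesis by simp
  qed
  finally have upper: "(\<Sum>D\<in>Pow I. e D * S D P s) \<le> real M * 2 ^ card I"
    unfolding expand .
  have "(\<Sum>D\<in>Pow I. e D * S D P s) = e {} * S {} P s + (\<Sum>D\<in>J. e D * S D P s)"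
    unfolding J_def using I by (intro sum.remove) auto
  moreover have "- (\<Sum>D\<in>J. C D + 3) \<le> (\<Sum>D\<in>J. e D * S D P s)"
    unfolding sum_negf[symmetric]
  proof (rule sum_mono)
    fix D assume D: "D \<in> J"
    then have "D \<subseteq> I" by (auto simp: J_def)
    have "\<bar>e D * S D P s\<bar> = \<bar>S D P s\<bar>"
      using abs_e[OF \<open>D \<subseteq> I\<close>] by (simp add: abs_mult)
    also have "\<dots> \<le> C D + 3"
      using P[OF \<open>D \<subseteq> I\<close>] sC[OF D] by linarith
    finally show "- (C D + 3) \<le> e D * S D P s" by linarith
  qed
  moreover have "S {} P s \<ge> ln (lseries (X {}) s) - 3"
    using P[OF empty_subsetI] by linarith
  moreover have "ln (lseries (X {}) s) > K"
    using sK by (metis exp_gt_zero ln_exp ln_less_cancel_iff order_less_trans)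
  ultimately show False
    using upper by (simp add: K_def e_def)
qed

section \<open>Sums of three squares\<close>

lemma Legendre_values: "Legendre a p = -1 \<or> Legendre a p = 0 \<or> Legendre a p = 1"
  by (simp add: Legendre_def)

lemma Legendre_eq_0_iff: "Legendre a p = 0 \<longleftrightarrow> p dvd a"
  by (simp add: Legendre_def cong_0_iff)

lemma Legendre_eq_1D:
  assumes "Legendre a p = 1"
  shows "\<exists>y. p dvd y\<^sup>2 - a"
proof -
  have "QuadRes p a"
    using assms by (simp add: Legendre_def split: if_split_asm)
  then show ?thesis
    unfolding QuadRes_def cong_iff_dvd_diff .
qed

lemma Legendre_cong: "[a = b] (mod p) \<Longrightarrow> Legendre a p = Legendre b p"
  by (simp add: Legendre_def QuadRes_def cong_def)

text \<open>Two values in \<open>{-1, 0, 1}\<close> differ by at most 2, which is less than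
  \<open>p\<close>; so the congruences from Euler's criterion give equalities.\<close>

lemma Legendre_eqI:
  fixes p :: nat
  assumes "2 < p" "[Legendre a p = c] (mod int p)" "c \<in> {-1, 0, 1}"
  shows "Legendre a p = c"
proof -
  have "int p dvd Legendre a p - c" "\<bar>Legendre a p - c\<bar> \<le> 2"
    using assms Legendre_values[of a p] by (auto simp: cong_iff_dvd_diff)
  then show ?thesis
    using assms(1) dvd_imp_le_int[of "Legendre a p - c" "int p"] by fastforce
qed

lemma Legendre_mult:
  fixes p :: nat
  assumes "prime p" "2 < p"
  shows "Legendre (a * b) p = Legendre a p * Legendre b p"
proof (rule Legendre_eqI[OF assms(2)])
  have "[Legendre a p * Legendre b p = a ^ ((p - 1) div 2) * b ^ ((p - 1) div 2)] (mod int p)"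
    using euler_criterion[OF assms] by (intro cong_mult)
  also have "a ^ ((p - 1) div 2) * b ^ ((p - 1) div 2) = (a * b) ^ ((p - 1) div 2)"
    by (simp add: power_mult_distrib)
  finally show "[Legendre (a * b) p = Legendre a p * Legendre b p] (mod int p)"
    by (rule cong_trans[OF euler_criterion[OF assms] cong_sym])
  show "Legendre a p * Legendre b p \<in> {-1, 0, 1}"
    using Legendre_values[of a p] Legendre_values[of b p] by auto
qed

lemma Legendre_1:
  fixes p :: nat
  assumes "2 < p"
  shows "Legendre 1 p = 1"
proof -
  have "QuadRes p 1"
    unfolding QuadRes_def by (rule exI[of _ 1]) simp
  moreover have "\<not> [1 = 0] (mod int p)"
    using assms by (simp add: cong_0_iff)
  ultimately show ?thesis
    by (simp add: Legendre_def)
qed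

lemma Legendre_prod:
  fixes p :: nat
  assumes "prime p" "2 < p"
  shows "Legendre (\<Prod>i\<in>A. f i) p = (\<Prod>i\<in>A. Legendre (f i) p)"
  using Legendre_1[OF assms(2)] by (induction A rule: infinite_finite_induct) (simp_all add: Legendre_mult[OF assms])

lemma Legendre_minus_1:
  fixes p :: nat
  assumes "prime p" "2 < p"
  shows "Legendre (-1) p = (if p mod 4 = 1 then 1 else -1)"
proof -
  have "odd p" using prime_odd_nat[OF assms] .
  then have "even ((p - 1) div 2) \<longleftrightarrow> p mod 4 = 1" by presburger
  then have "(-1::int) ^ ((p - 1) div 2) = (if p mod 4 = 1 then 1 else -1)" by simp
  then show ?thesis
    using euler_criterion[OF assms, of "-1"] by (intro Legendre_eqI[OF assms(2)]) auto
qed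

lemma Legendre_minus_1_cong:
  fixes p :: nat
  assumes "prime p" "2 < p"
  shows "[Legendre (-1) p = int p] (mod 4)"
proof -
  have "odd p" using prime_odd_nat[OF assms] .
  then have "p mod 4 = 1 \<or> p mod 4 = 3" by presburger
  then have "int p mod 4 = 1 \<and> p mod 4 = 1 \<or> int p mod 4 = 3 \<and> p mod 4 = 3" by presburger
  then show ?thesis unfolding Legendre_minus_1[OF assms] by (auto simp: cong_def)
qed

text \<open>Gauss's lemma: for \<open>q = 4 * k + 1\<close> the doubles falling into the upper half
  are \<open>2 * y\<close> with \<open>k < y \<le> 2 * k\<close>, so there are \<open>k\<close> sign
  changes.\<close>

lemma Legendre_2:
  fixes q :: nat
  assumes "prime q" "q mod 4 = 1"
  shows "Legendre 2 q = (if q mod 8 = 1 then 1 else -1)"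
proof -
  have "q \<noteq> 1" using assms by auto
  moreover have "q > 0" using assms prime_gt_0_nat by blast
  ultimately have q: "2 < q" using assms(2) by presburger
  obtain k where k: "q = 4 * k + 1"
    using assms(2) by (metis mult_div_mod_eq)
  interpret GAUSS q 2
  proof
    show "[2 \<noteq> 0] (mod int q)"
      using q by (auto simp: cong_0_iff dest: zdvd_imp_le)
  qed (use assms q in auto)
  have half: "(int q - 1) div 2 = 2 * int k" using k by simp
  have "E = (\<lambda>x. 2 * x) ` {int k<..2 * int k}"
  proof (intro equalityI subsetI)
    fix x assume "x \<in> E"
    then obtain y where y: "0 < y" "y \<le> 2 * int k" "x = y * 2 mod int q" "2 * int k < x"
      unfolding E_def C_def B_def A_def half by auto
    then have "x = 2 * y" using k by simp
    then show "x \<in> (\<lambda>x. 2 * x) ` {int k<..2 * int k}" using y by auto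
  next
    fix x assume "x \<in> (\<lambda>x. 2 * x) ` {int k<..2 * int k}"
    then obtain y where y: "int k < y" "y \<le> 2 * int k" "x = 2 * y" by auto
    then have "x = y * 2 mod int q" using k by simp
    then show "x \<in> E"
      using y unfolding E_def C_def B_def A_def half by force
  qed
  then have "card E = k"
    by (simp add: card_image inj_on_def)
  then have "Legendre 2 q = (-1) ^ k"
    using gauss_lemma by simp
  moreover have "even k \<longleftrightarrow> q mod 8 = 1" using k by presburger
  ultimately show ?thesis by simp
qed

text \<open>Squaring identifies 1 and -1, so it cannot be surjective on the finite set of nonzero
  residues.\<close>

lemma quadratic_nonresidue_exists:
  fixes p :: nat
  assumes "prime p" "2 < p"
  shows "\<exists>a::nat. Legendre (int a) (int p) = -1"
proof (rule ccontr)
  assume *: "\<not> ?thesis"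
  define f where "f y = (y * y) mod int p" for y
  have sub: "{1..int p - 1} \<subseteq> f ` {1..int p - 1}"
  proof
    fix a assume a: "a \<in> {1..int p - 1}"
    then have "Legendre a p \<noteq> 0"
      by (auto simp: Legendre_eq_0_iff dest: zdvd_imp_le)
    moreover have "Legendre a p \<noteq> -1"
    proof
      assume "Legendre a p = -1"
      then have "Legendre (int (nat a)) p = -1" using a by simp
      with * show False by blast
    qed
    ultimately have "Legendre a p = 1"
      using Legendre_values[of a p] by auto
    then obtain y where y: "int p dvd y\<^sup>2 - a" using Legendre_eq_1D by blast
    then have "(y * y) mod int p = a mod int p" by (simp add: mod_eq_dvd_iff power2_eq_square)
    also have "\<dots> = a" using a by simp
    finally have eq: "f (y mod int p) = a" by (simp add: f_def mod_mult_eq)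
    have "y mod int p \<noteq> 0"
      using eq a by (auto simp: f_def)
    moreover have "0 \<le> y mod int p" "y mod int p < int p" using assms(2) by simp_all
    ultimately have "y mod int p \<in> {1..int p - 1}" by auto
    with eq show "a \<in> f ` {1..int p - 1}" by blast
  qed
  have "inj_on f {1..int p - 1}"
    using sub card_mono[OF _ sub] card_image_le[of "{1..int p - 1}" f]
    by (intro eq_card_imp_inj_on) auto
  moreover have "f 1 = f (int p - 1)"
  proof -
    have "(int p - 1) * (int p - 1) = 1 + int p * (int p - 2)" by (simp add: algebra_simps)
    then have "f (int p - 1) = 1 mod int p" by (simp only: f_def mod_mult_self2)
    then show ?thesis by (simp add: f_def)
  qed
  ultimately show False
    using assms(2) by (auto dest: inj_onD[of f _ 1 "int p - 1"])
qed

text \<open>The line from the rational point \<open>(x, y, z) / T\<close> through a nearest lattice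
  point \<open>(a, b, c)\<close> meets the sphere again in a point with denominator
  \<open>T'\<close>. Rounding makes \<open>T * T'\<close> at most three quarters of
  \<open>T\<^sup>2\<close>. If \<open>T' = 0\<close>, the lattice point itself lies on the
  sphere.\<close>

lemma davenport_cassels_three_squares:
  fixes N T x y z :: int
  assumes "T > 0" "N * T\<^sup>2 = x\<^sup>2 + y\<^sup>2 + z\<^sup>2"
  shows "\<exists>a b c. N = a\<^sup>2 + b\<^sup>2 + c\<^sup>2"
  using assms
proof (induction "nat T" arbitrary: T x y z rule: less_induct)
  case less
  note T = \<open>T > 0\<close> and eq = less.prems(2)
  have "\<exists>c r. v = T * c + r \<and> 4 * r\<^sup>2 \<le> T\<^sup>2" for v :: int
  proof -
    define c where "c = (2 * v + T) div (2 * T)"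
    define r where "r = v - T * c"
    have "2 * v + T = 2 * T * c + (2 * v + T) mod (2 * T)"
      unfolding c_def by simp
    moreover have "0 \<le> (2 * v + T) mod (2 * T)" "(2 * v + T) mod (2 * T) < 2 * T"
      using T by simp_all
    ultimately have "\<bar>2 * r\<bar> \<le> \<bar>T\<bar>"
      unfolding r_def by (simp add: algebra_simps)
    then have "(2 * r)\<^sup>2 \<le> T\<^sup>2"
      by (simp only: abs_le_square_iff)
    then have "4 * r\<^sup>2 \<le> T\<^sup>2"
      by (simp add: power_mult_distrib)
    moreover have "v = T * c + r"
      by (simp add: r_def)
    ultimately show ?thesis by blast
  qed
  then obtain a b c r s t where v: "x = T * a + r" "y = T * b + s" "z = T * c + t"
    and le: "4 * r\<^sup>2 \<le> T\<^sup>2" "4 * s\<^sup>2 \<le> T\<^sup>2" "4 * t\<^sup>2 \<le> T\<^sup>2"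
    by meson
  define P where "P = x * a + y * b + z * c"
  define Q where "Q = a\<^sup>2 + b\<^sup>2 + c\<^sup>2"
  define T' where "T' = N * T - 2 * P + T * Q"
  have TT': "T * T' = r\<^sup>2 + s\<^sup>2 + t\<^sup>2"
  proof -
    have "T * T' = N * T\<^sup>2 - 2 * T * P + T\<^sup>2 * Q"
      by (simp add: T'_def power2_eq_square algebra_simps)
    also have "\<dots> = r\<^sup>2 + s\<^sup>2 + t\<^sup>2"
      unfolding eq P_def Q_def by (simp add: v power2_eq_square algebra_simps)
    finally show ?thesis .
  qed
  show ?case
  proof (cases "T' = 0")
    case True
    with TT' have "r = 0 \<and> s = 0 \<and> t = 0"
      by (metis add_eq_0_iff mult_zero_right add_nonneg_eq_0_iff sum_power2_eq_zero_iff zero_eq_power2 zero_le_power2 add_nonneg_nonneg)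
    with v eq have "T\<^sup>2 * N = T\<^sup>2 * (a\<^sup>2 + b\<^sup>2 + c\<^sup>2)"
      by (simp add: power_mult_distrib algebra_simps)
    with T show ?thesis
      by auto
  next
    case False
    have "T * T' < T * T"
      using le TT' mult_pos_pos[OF T T] unfolding power2_eq_square by linarith
    then have less: "T' < T"
      using T by simp
    have "0 \<le> T * T'"
      unfolding TT' by simp
    with T False have pos: "T' > 0"
      by (simp add: zero_le_mult_iff)
    \<comment> \<open>The second intersection point has numerators \<open>k * x + l * a\<close> and
      so on, over the denominator \<open>k * T + l\<close>.\<close>
    define k where "k = Q - N"
    define l where "l = 2 * (N * T - P)"
    have T'_eq: "T' = k * T + l"
      by (simp add: T'_def k_def l_def algebra_simps)
    have "(k * x + l * a)\<^sup>2 + (k * y + l * b)\<^sup>2 + (k * z + l * c)\<^sup>2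
        = k\<^sup>2 * (x\<^sup>2 + y\<^sup>2 + z\<^sup>2) + 2 * k * l * P + l\<^sup>2 * Q"
      by (simp add: P_def Q_def power2_eq_square algebra_simps)
    also have "\<dots> = N * T'\<^sup>2 + (l * k * (2 * (P - N * T)) + l * l * (Q - N))"
      unfolding T'_eq eq[symmetric] by (simp add: power2_eq_square algebra_simps)
    also have "l * k * (2 * (P - N * T)) + l * l * (Q - N) = 0"
      unfolding k_def by (simp add: l_def algebra_simps)
    finally have "N * T'\<^sup>2 = (k * x + l * a)\<^sup>2 + (k * y + l * b)\<^sup>2 + (k * z + l * c)\<^sup>2"
      by simp
    then show ?thesis
      using less.hyps[of T'] less pos by auto
  qed
qed

section \<open>A ternary quadratic equation solved by the pigeonhole principle\<close>

lemma ceiling_sqrt_int: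
  fixes m :: int
  assumes "m > 0"
  obtains k :: int where "k \<ge> 1" "(k - 1)\<^sup>2 < m" "m \<le> k\<^sup>2"
proof -
  define P where "P k \<longleftrightarrow> m \<le> (int k)\<^sup>2" for k
  have "m \<le> m\<^sup>2"
    using assms by (simp add: self_le_power)
  then have "P (nat m)"
    using assms by (simp add: P_def)
  then have P: "P (LEAST k. P k)"
    by (rule LeastI)
  define k where "k = (LEAST k. P k)"
  have "k \<noteq> 0"
    using P assms unfolding k_def[symmetric] by (metis P_def less_le_not_le of_nat_0 zero_power2)
  then have "\<not> P (k - 1)"
    using not_less_Least[of "k - 1" P] by (simp add: k_def)
  with P \<open>k \<noteq> 0\<close> show ?thesis
    unfolding k_def[symmetric]
    by (intro that[of "int k"]) (auto simp: P_def of_nat_diff)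
qed

text \<open>The box \<open>D\<close> has more than \<open>N * q\<close> points, so two of them agree
  in \<open>z - r * u\<close> modulo \<open>N\<close> and in \<open>z - s * t\<close> modulo
  \<open>q\<close>. For their difference, \<open>V\<close> is a multiple of \<open>q * N\<close>
  strictly between \<open>- q * N\<close> and \<open>2 * q * N\<close>, hence 0 or
  \<open>q * N\<close>.\<close>

lemma ternary_isotropic:
  fixes N q r s :: int
  assumes N: "N > 0" and q: "q > 0" and cop: "coprime q N"
    and r: "N dvd r\<^sup>2 + q" and s: "q dvd s\<^sup>2 - N"
  shows "\<exists>z u t. t \<noteq> 0 \<and> z\<^sup>2 + q * u\<^sup>2 = N * t\<^sup>2"
proof -
  obtain A where A: "A \<ge> 1" "(A - 1)\<^sup>2 < q * N" "q * N \<le> A\<^sup>2"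
    using ceiling_sqrt_int[of "q * N"] N q by auto
  \<comment> \<open>Taking \<open>N + 1\<close> instead of \<open>N\<close> makes the box strictly
    larger than \<open>q * N\<close>, while \<open>u\<^sup>2 \<le> N\<close> still holds.\<close>
  obtain B where B: "B \<ge> 1" "(B - 1)\<^sup>2 < N + 1" "N + 1 \<le> B\<^sup>2"
    using ceiling_sqrt_int[of "N + 1"] N by auto
  obtain C where C: "C \<ge> 1" "(C - 1)\<^sup>2 < q" "q \<le> C\<^sup>2"
    using ceiling_sqrt_int[of q] q by auto
  define D where "D = {0..<A} \<times> {0..<B} \<times> {0..<C}"
  define f where "f = (\<lambda>(z, u, t). ((z - r * u) mod N, (z - s * t) mod q))"
  have "(q * N)\<^sup>2 < (A * B * C)\<^sup>2"
  proof -
    have "(q * N)\<^sup>2 < q * N * (N + 1) * q"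
      using N q by (simp add: power2_eq_square algebra_simps)
    also have "\<dots> \<le> A\<^sup>2 * B\<^sup>2 * C\<^sup>2"
      using A B C N q by (intro mult_mono) auto
    finally show ?thesis
      by (simp add: power_mult_distrib)
  qed
  then have less: "q * N < A * B * C"
    using A B C by (meson power2_less_imp_less mult_nonneg_nonneg order_trans zero_le_one)
  have "card D = nat A * nat B * nat C"
    by (simp add: D_def card_cartesian_product)
  also have "\<dots> = nat (A * B * C)"
    using A B C by (simp add: nat_mult_distrib)
  finally have "card D > nat (N * q)"
    using less A B C by (simp add: mult.commute[of N] zless_nat_conj)
  moreover have "f ` D \<subseteq> {0..<N} \<times> {0..<q}"
    using N q by (auto simp: f_def)
  then have "card (f ` D) \<le> card ({0..<N} \<times> {0..<q})"
    by (intro card_mono) auto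
  then have "card (f ` D) \<le> nat (N * q)"
    using N q by (simp add: card_cartesian_product nat_mult_distrib)
  ultimately have "\<not> inj_on f D"
    by (intro pigeonhole) simp
  then obtain z1 u1 t1 z2 u2 t2 where
    mem: "(z1, u1, t1) \<in> D" "(z2, u2, t2) \<in> D" "(z1, u1, t1) \<noteq> (z2, u2, t2)"
    and feq: "f (z1, u1, t1) = f (z2, u2, t2)"
    unfolding inj_on_def by fastforce
  define z where "z = z1 - z2"
  define u where "u = u1 - u2"
  define t where "t = t1 - t2"
  have "N dvd (z1 - r * u1) - (z2 - r * u2)" "q dvd (z1 - s * t1) - (z2 - s * t2)"
    using feq by (simp_all add: f_def mod_eq_dvd_iff)
  then have dvd: "N dvd z - r * u" "q dvd z - s * t"
    by (simp_all add: z_def u_def t_def algebra_simps)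
  have bounds: "\<bar>z\<bar> \<le> \<bar>A - 1\<bar>" "\<bar>u\<bar> \<le> \<bar>B - 1\<bar>" "\<bar>t\<bar> \<le> \<bar>C - 1\<bar>"
    using mem by (auto simp: D_def z_def u_def t_def)
  then have sq: "z\<^sup>2 < q * N" "u\<^sup>2 \<le> N" "t\<^sup>2 < q"
    unfolding abs_le_square_iff using A B C by linarith+
  define V where "V = z\<^sup>2 + q * u\<^sup>2 - N * t\<^sup>2"
  have "V = (z - r * u) * (z + r * u) + (r\<^sup>2 + q) * u\<^sup>2 - N * t\<^sup>2"
    by (simp add: V_def power2_eq_square algebra_simps)
  then have "N dvd V"
    using dvd r by simp
  have "V = (z - s * t) * (z + s * t) + (s\<^sup>2 - N) * t\<^sup>2 + q * u\<^sup>2"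
    by (simp add: V_def power2_eq_square algebra_simps)
  then have "q dvd V"
    using dvd s by simp
  with \<open>N dvd V\<close> cop have "q * N dvd V"
    by (simp add: divides_mult)
  then obtain k where k: "V = q * N * k" ..
  have "N * t\<^sup>2 < q * N" "q * u\<^sup>2 \<le> q * N"
    using sq N q by (simp_all add: mult.commute)
  moreover have "0 \<le> q * u\<^sup>2" "0 \<le> N * t\<^sup>2" "0 \<le> z\<^sup>2"
    using N q by simp_all
  ultimately have "V < q * N * 2" "q * N * (-1) < V"
    unfolding V_def using sq(1) by linarith+
  then have "k < 2" "-1 < k"
    unfolding k using N q by (simp_all only: mult_less_cancel_left_pos mult_pos_pos)
  then consider "k = 0" | "k = 1"
    by linarith
  then show ?thesis
  proof cases
    case 1
    then have eq: "z\<^sup>2 + q * u\<^sup>2 = N * t\<^sup>2"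
      using k by (simp add: V_def)
    have "t \<noteq> 0"
    proof
      assume "t = 0"
      with eq q have "z = 0 \<and> u = 0"
        by (auto simp: add_nonneg_eq_0_iff)
      with \<open>t = 0\<close> mem(3) show False
        by (simp add: z_def u_def t_def)
    qed
    with eq show ?thesis by blast
  next
    case 2
    then have "z\<^sup>2 + q * u\<^sup>2 = N * (t\<^sup>2 + q)"
      using k by (simp add: V_def algebra_simps)
    then have "(z\<^sup>2 + q * u\<^sup>2) * (t\<^sup>2 + q) = N * (t\<^sup>2 + q)\<^sup>2"
      by (simp add: power2_eq_square)
    \<comment> \<open>The norms of \<open>z + u * sqrt (-q)\<close> and \<open>t + sqrt (-q)\<close>
      multiply, which converts the case \<open>V = q * N\<close> into a solution.\<close>
    then have "(z * t - q * u)\<^sup>2 + q * (z + u * t)\<^sup>2 = N * (t\<^sup>2 + q)\<^sup>2"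
      by (simp add: power2_eq_square algebra_simps)
    moreover have "t\<^sup>2 + q \<noteq> 0"
      using q by (smt (verit) zero_le_power2)
    ultimately show ?thesis by blast
  qed
qed

section \<open>The auxiliary prime for the three squares theorem\<close>

lemma real_character_dvd:
  assumes "real_character m \<psi>" "m dvd M"
  shows "real_character M \<psi>"
proof -
  obtain q where "M = q * m" using assms(2) by (metis dvdE mult.commute)
  then have "\<psi> (n + M) = \<psi> n" for n
    using character_periodic_mult[OF assms(1)] by simp
  then show ?thesis using assms(1) unfolding real_character_def by blast
qed

text \<open>At odd primes this is the Legendre symbol of -1.\<close>

definition chi4 :: "nat \<Rightarrow> real" where
  "chi4 n = (if even n then 0 else if n mod 4 = 1 then 1 else -1)"

text \<open>At odd primes this is the Legendre symbol of 2.\<close>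

definition chi8 :: "nat \<Rightarrow> real" where
  "chi8 n = (if even n then 0 else if n mod 8 = 1 \<or> n mod 8 = 7 then 1 else -1)"

lemma real_character_chi4: "real_character 4 chi4"
proof -
  have "chi4 (m * n) = chi4 m * chi4 n" for m n
  proof (cases "even m \<or> even n")
    case False
    then have "m mod 4 = 1 \<or> m mod 4 = 3" "n mod 4 = 1 \<or> n mod 4 = 3" by presburger+
    moreover have "(m * n) mod 4 = ((m mod 4) * (n mod 4)) mod 4" by (simp add: mod_mult_eq)
    ultimately show ?thesis using False by (auto simp: chi4_def)
  qed (auto simp: chi4_def)
  then show ?thesis by (auto simp: real_character_def chi4_def)
qed

lemma real_character_chi8: "real_character 8 chi8"
proof -
  have "chi8 (m * n) = chi8 m * chi8 n" for m n
  proof (cases "even m \<or> even n")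
    case False
    then have "m mod 8 = 1 \<or> m mod 8 = 3 \<or> m mod 8 = 5 \<or> m mod 8 = 7"
      "n mod 8 = 1 \<or> n mod 8 = 3 \<or> n mod 8 = 5 \<or> n mod 8 = 7" by presburger+
    moreover have "(m * n) mod 8 = ((m mod 8) * (n mod 8)) mod 8" by (simp add: mod_mult_eq)
    ultimately show ?thesis using False by (auto simp: chi8_def)
  qed (auto simp: chi8_def)
  then show ?thesis by (auto simp: real_character_def chi8_def)
qed

lemma real_character_Legendre:
  assumes "prime p" "2 < p"
  shows "real_character p (\<lambda>n. of_int (Legendre (int n) (int p)))"
proof -
  have "Legendre (int (n + p)) (int p) = Legendre (int n) (int p)" for n
    by (rule Legendre_cong) (simp add: cong_def)
  moreover have "real_of_int (Legendre (int n) (int p)) \<in> {-1, 0, 1}" for n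
    using Legendre_values[of "int n" "int p"] by (elim disjE) simp_all
  ultimately show ?thesis
    using Legendre_1[OF assms(2)] unfolding real_character_def by (simp add: Legendre_mult[OF assms])
qed

text \<open>\<open>chi4\<close>, \<open>chi8\<close> and the Legendre symbols at the primes in
  \<open>A\<close> are independent by the Chinese remainder theorem. Once \<open>chi4 q = 1\<close>,
  the value of \<open>chi8\<close> decides between 1 and 5 modulo 8.\<close>

lemma prime_with_prescribed_residue_symbols:
  fixes A :: "nat set" and \<epsilon> :: "nat \<Rightarrow> int"
  assumes "finite A" and A: "\<And>p. p \<in> A \<Longrightarrow> prime p \<and> 2 < p"
    and \<epsilon>: "\<And>p. p \<in> A \<Longrightarrow> \<epsilon> p = 1 \<or> \<epsilon> p = -1"
  shows "\<exists>q. prime q \<and> q mod 4 = 1 \<and> (q mod 8 = 1 \<longleftrightarrow> \<delta>) \<and> (\<forall>p\<in>A. Legendre (int q) (int p) = \<epsilon> p)"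
proof -
  \<comment> \<open>Indices 0 and 1 are free for \<open>chi4\<close> and \<open>chi8\<close>,
    because \<open>A\<close> contains only primes above 2.\<close>
  define \<psi> :: "nat \<Rightarrow> nat \<Rightarrow> real" where
    "\<psi> i = (if i = 0 then chi4 else if i = 1 then chi8 else (\<lambda>n. of_int (Legendre (int n) (int i))))" for i
  define \<eta> :: "nat \<Rightarrow> real" where
    "\<eta> i = (if i = 0 then 1 else if i = 1 then (if \<delta> then 1 else -1) else of_int (\<epsilon> i))" for i
  define I where "I = {0, 1} \<union> A"
  define M where "M = 8 * \<Prod>A"
  have A01: "0 \<notin> A" "1 \<notin> A" using A by fastforce+
  have \<psi>A: "\<psi> p = (\<lambda>n. of_int (Legendre (int n) (int p)))" if "p \<in> A" for p
    using A[OF that] by (auto simp: \<psi>_def)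
  have dvdM: "p dvd M" if "p \<in> A" for p
    using dvd_prodI[OF assms(1) that, of id] by (simp add: M_def)
  have odd_coprime_8: "coprime c 8" if "odd c" for c :: nat
  proof -
    have "coprime c (2 ^ 3)" unfolding coprime_power_right_iff using that by simp
    then show ?thesis by simp
  qed
  have odd_coprime: "coprime 8 (\<Prod>B)" if "B \<subseteq> A" for B
  proof (rule prod_coprime_right)
    fix p assume "p \<in> B"
    then have "odd p" using A that prime_odd_nat by blast
    then show "coprime 8 p" using odd_coprime_8 by (simp add: coprime_commute)
  qed
  have one: "\<psi> p c = 1" if "p \<in> A" "[c = 1] (mod p)" for p c
  proof -
    have "[int c = 1] (mod int p)" using that(2) by (metis cong_int_iff of_nat_1)
    then have "Legendre (int c) (int p) = Legendre 1 (int p)" by (rule Legendre_cong)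
    then show ?thesis using Legendre_1[of p] A[OF that(1)] by (simp add: \<psi>A[OF that(1)])
  qed
  have chi_one: "\<psi> 0 c = 1" "\<psi> 1 c = 1" if "[c = 1] (mod 8)" for c
  proof -
    have "c mod 8 = 1" using that by (simp add: cong_def)
    moreover from this have "odd c" "c mod 4 = 1" by presburger+
    ultimately show "\<psi> 0 c = 1" "\<psi> 1 c = 1" by (simp_all add: \<psi>_def chi4_def chi8_def)
  qed
  have cong_A: "[c = 1] (mod p)" if "[c = 1] (mod \<Prod>B)" "p \<in> B" "B \<subseteq> A" for c p B
  proof -
    have "finite B" using that(3) assms(1) by (rule finite_subset)
    then have "p dvd \<Prod>B" using dvd_prodI[of B p id] that(2) by simp
    with that(1) show ?thesis by (rule cong_dvd_modulus_nat)
  qed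
  have "\<exists>q. prime q \<and> coprime q M \<and> (\<forall>i\<in>I. \<psi> i q = \<eta> i)"
  proof (rule prime_with_prescribed_characters)
    show "finite I" using assms(1) by (simp add: I_def)
    show "M > 0" using A assms(1) by (auto simp: M_def intro!: prod_pos prime_gt_0_nat)
  next
    fix i assume "i \<in> I"
    then consider "i = 0" | "i = 1" | "i \<in> A" by (auto simp: I_def)
    then show "real_character M (\<psi> i)"
    proof cases
      case 1
      have "4 dvd M" by (simp add: M_def dvd_mult2)
      then show ?thesis using 1 real_character_dvd[OF real_character_chi4] by (simp add: \<psi>_def)
    next
      case 2
      have "8 dvd M" by (simp add: M_def)
      then show ?thesis using 2 real_character_dvd[OF real_character_chi8] by (simp add: \<psi>_def)
    next
      case 3
      then show ?thesis
        using real_character_dvd[OF real_character_Legendre dvdM[OF 3]] A[OF 3] by (simp add: \<psi>A)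
    qed
    show "\<eta> i = 1 \<or> \<eta> i = -1"
      using \<epsilon>[of i] \<open>i \<in> I\<close> by (auto simp: \<eta>_def I_def)
  next
    fix i n assume "i \<in> I" and cop: "coprime n M"
    then consider "i = 0 \<or> i = 1" | "i \<in> A" by (auto simp: I_def)
    then show "\<psi> i n \<noteq> 0"
    proof cases
      case 1
      have "coprime n 8" using cop by (simp add: M_def)
      then have "odd n" using coprime_common_divisor_nat[of n 8 2] by auto
      then show ?thesis using 1 by (auto simp: \<psi>_def chi4_def chi8_def)
    next
      case 2
      then have p: "prime i" using A by blast
      have "\<not> i dvd n"
      proof
        assume "i dvd n"
        with dvdM[OF 2] cop have "i = 1" using coprime_common_divisor_nat by blast
        with p show False by simp
      qed
      then show ?thesis by (simp add: \<psi>A[OF 2] Legendre_eq_0_iff)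
    qed
  next
    fix i assume "i \<in> I"
    then consider "i = 0" | "i = 1" | "i \<in> A" by (auto simp: I_def)
    then show "\<exists>c. coprime c M \<and> \<psi> i c = -1 \<and> (\<forall>j\<in>I - {i}. \<psi> j c = 1)"
    proof cases
      case 1
      \<comment> \<open>The class of 7 has \<open>chi4\<close> value -1 and \<open>chi8\<close>
        value 1; the class of 5, used in the next case, has the opposite values.\<close>
      obtain c where c: "[c = 7] (mod 8)" "[c = 1] (mod \<Prod>A)"
        using binary_chinese_remainder_nat[OF odd_coprime[of A], of 7 1] by auto
      have "c mod 8 = 7" using c(1) by (simp add: cong_def)
      then have "odd c" "c mod 4 = 3" by presburger+
      with \<open>c mod 8 = 7\<close> have "\<psi> 0 c = -1" "\<psi> 1 c = 1" by (simp_all add: \<psi>_def chi4_def chi8_def)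
      moreover have "coprime c 8"
        using \<open>odd c\<close> by (rule odd_coprime_8)
      moreover have "coprime c (\<Prod>A)"
        using cong_imp_coprime[OF cong_sym[OF c(2)]] by simp
      moreover have "\<psi> j c = 1" if "j \<in> A" for j
        using one[OF that cong_A[OF c(2) that subset_refl]] .
      ultimately show ?thesis
        using 1 by (intro exI[of _ c]) (auto simp: M_def I_def)
    next
      case 2
      obtain c where c: "[c = 5] (mod 8)" "[c = 1] (mod \<Prod>A)"
        using binary_chinese_remainder_nat[OF odd_coprime[of A], of 5 1] by auto
      have "c mod 8 = 5" using c(1) by (simp add: cong_def)
      then have "odd c" "c mod 4 = 1" by presburger+
      with \<open>c mod 8 = 5\<close> have "\<psi> 0 c = 1" "\<psi> 1 c = -1" by (simp_all add: \<psi>_def chi4_def chi8_def)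
      moreover have "coprime c 8"
        using \<open>odd c\<close> by (rule odd_coprime_8)
      moreover have "coprime c (\<Prod>A)"
        using cong_imp_coprime[OF cong_sym[OF c(2)]] by simp
      moreover have "\<psi> j c = 1" if "j \<in> A" for j
        using one[OF that cong_A[OF c(2) that subset_refl]] .
      ultimately show ?thesis
        using 2 by (intro exI[of _ c]) (auto simp: M_def I_def)
    next
      case 3
      then have p: "prime i" "2 < i" using A by blast+
      obtain a where a: "Legendre (int a) (int i) = -1"
        using quadratic_nonresidue_exists[OF p] by blast
      define B where "B = A - {i}"
      have PA: "\<Prod>A = i * \<Prod>B"
        unfolding B_def using assms(1) 3 by (rule prod.remove)
      have cop: "coprime i (8 * \<Prod>B)"
      proof -
        have "coprime i 8" using odd_coprime[of "{i}"] 3 by (simp add: coprime_commute)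
        moreover have "coprime i (\<Prod>B)"
          using A p by (intro prod_coprime_right primes_coprime) (auto simp: B_def)
        ultimately show ?thesis by simp
      qed
      obtain c where c: "[c = a] (mod i)" "[c = 1] (mod 8 * \<Prod>B)"
        using binary_chinese_remainder_nat[OF cop] by blast
      have c8: "[c = 1] (mod 8)" and cB: "[c = 1] (mod \<Prod>B)"
        using c(2) by (auto elim: cong_dvd_modulus_nat)
      have "[int c = int a] (mod int i)" using c(1) by (simp add: cong_int_iff)
      then have Lc: "Legendre (int c) (int i) = -1" using a Legendre_cong by metis
      then have "\<psi> i c = -1" by (simp add: \<psi>A[OF 3])
      moreover have "\<not> i dvd c"
        using Lc Legendre_eq_0_iff[of "int c" "int i"] by auto
      then have "coprime c i" using prime_imp_coprime[OF p(1)] by (simp add: coprime_commute)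
      moreover have "coprime c (8 * \<Prod>B)"
        using cong_imp_coprime[OF cong_sym[OF c(2)]] by simp
      moreover have "\<psi> j c = 1" if "j \<in> I - {i}" for j
      proof -
        have "j = 0 \<or> j = 1 \<or> j \<in> B" using that by (auto simp: I_def B_def)
        then show ?thesis
          using chi_one[OF c8] one[of j c] cong_A[OF cB, of j] by (auto simp: B_def)
      qed
      ultimately show ?thesis
        by (intro exI[of _ c]) (auto simp: M_def PA)
    qed
  qed
  then obtain q where q: "prime q" "coprime q M" "\<And>i. i \<in> I \<Longrightarrow> \<psi> i q = \<eta> i" by blast
  have "chi4 q = 1" "chi8 q = (if \<delta> then 1 else -1)"
    using q(3)[of 0] q(3)[of 1] by (simp_all add: I_def \<psi>_def \<eta>_def)
  then have q4: "q mod 4 = 1" and q8: "(q mod 8 = 1 \<or> q mod 8 = 7) \<longleftrightarrow> \<delta>"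
    by (auto simp: chi4_def chi8_def split: if_splits)
  have "q mod 8 \<noteq> 7" using q4 by presburger
  with q8 have "q mod 8 = 1 \<longleftrightarrow> \<delta>" by blast
  moreover have "Legendre (int q) (int p) = \<epsilon> p" if "p \<in> A" for p
    using q(3)[of p] A[OF that] that by (simp add: \<psi>A[OF that] \<eta>_def I_def)
  ultimately show ?thesis using q(1) q4 by blast
qed

lemma square_root_mod_prod_primes:
  fixes B :: "nat set" and a :: int
  assumes "finite B" "\<And>p. p \<in> B \<Longrightarrow> prime p" "\<And>p. p \<in> B \<Longrightarrow> \<exists>r. int p dvd r\<^sup>2 + a"
  shows "\<exists>r. int (\<Prod>B) dvd r\<^sup>2 + a"
  using assms
proof (induction B rule: finite_induct)
  case (insert p B)
  then obtain r1 r2 where r: "int p dvd r1\<^sup>2 + a" "int (\<Prod>B) dvd r2\<^sup>2 + a"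
    by fastforce
  have "coprime p (\<Prod>B)"
    using insert by (intro prod_coprime_right primes_coprime) auto
  then have cop: "coprime (int p) (int (\<Prod>B))" by (simp only: coprime_int_iff)
  obtain r where cong: "[r = r1] (mod int p)" "[r = r2] (mod int (\<Prod>B))"
    using binary_chinese_remainder_int[OF cop] by blast
  have "[r\<^sup>2 + a = r1\<^sup>2 + a] (mod int p)" "[r\<^sup>2 + a = r2\<^sup>2 + a] (mod int (\<Prod>B))"
    using cong by (auto intro!: cong_add cong_pow)
  then have "int p dvd r\<^sup>2 + a" "int (\<Prod>B) dvd r\<^sup>2 + a"
    using r by (metis cong_dvd_iff)+
  then have "int p * int (\<Prod>B) dvd r\<^sup>2 + a" using cop by (intro divides_mult)
  then show ?case using insert.hyps by (intro exI[of _ r]) simp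
qed simp

text \<open>The choice (q/p) = (-1/p) at odd primes \<open>p\<close> dividing \<open>N\<close> makes
  \<open>-q\<close> a square modulo \<open>N\<close>. By reciprocity (N/q) is the product
  \<open>E\<close> of these signs if \<open>N\<close> is odd, and (2/q) times \<open>E\<close> if
  \<open>N\<close> is even. In the first case \<open>E = 1\<close> because \<open>N\<close> is 1
  modulo 4; in the second the class of \<open>q\<close> modulo 8 gives (2/q) =
  \<open>E\<close>.\<close>

lemma squarefree_three_squares:
  fixes N :: nat
  assumes sqf: "squarefree N" and N4: "N mod 4 = 1 \<or> N mod 4 = 2"
  shows "\<exists>a b c :: int. int N = a\<^sup>2 + b\<^sup>2 + c\<^sup>2"
proof -
  have "N > 0" using N4 by (cases N) auto
  define A where "A = prime_factors N - {2}"
  have finA: "finite A" by (simp add: A_def)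
  have A: "prime p \<and> 2 < p" if "p \<in> A" for p
    using that prime_ge_2_nat[of p] by (auto simp: A_def in_prime_factors_iff)
  have "N = (\<Prod>p\<in>prime_factors N. p ^ multiplicity p N)"
    using \<open>N > 0\<close> by (rule prime_factorization_nat)
  also have "\<dots> = \<Prod>(prime_factors N)"
    using sqf squarefree_factorial_semiring'[of N] \<open>N > 0\<close> by (intro prod.cong) auto
  finally have prodN: "N = \<Prod>(prime_factors N)" .
  have N_even: "N = 2 * \<Prod>A" if "even N"
  proof -
    have "2 \<in> prime_factors N" using that \<open>N > 0\<close> by (simp add: in_prime_factors_iff)
    then have "\<Prod>(prime_factors N) = 2 * \<Prod>A" unfolding A_def by (intro prod.remove) simp_all
    with prodN show ?thesis by simp
  qed
  have N_odd: "N = \<Prod>A" if "odd N"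
  proof -
    have "2 \<notin> prime_factors N" using that by (auto simp: in_prime_factors_iff)
    then have "A = prime_factors N" by (simp add: A_def)
    with prodN show ?thesis by simp
  qed
  define \<epsilon> where "\<epsilon> p = Legendre (-1) (int p)" for p :: nat
  have \<epsilon>: "\<epsilon> p = 1 \<or> \<epsilon> p = -1" if "p \<in> A" for p
    using Legendre_minus_1[of p] A[OF that] by (simp add: \<epsilon>_def)
  define E where "E = (\<Prod>p\<in>A. \<epsilon> p)"
  have E: "E = 1 \<or> E = -1"
  proof -
    have "\<bar>E\<bar> = (\<Prod>p\<in>A. \<bar>\<epsilon> p\<bar>)" by (simp add: E_def abs_prod)
    also have "\<dots> = 1" using \<epsilon> by (intro prod.neutral) force
    finally show ?thesis by linarith
  qed
  have "[E = (\<Prod>p\<in>A. int p)] (mod 4)"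
    unfolding E_def \<epsilon>_def using A Legendre_minus_1_cong by (intro cong_prod) blast
  then have E4: "[E = int (\<Prod>A)] (mod 4)" by simp
  obtain q where q: "prime q" "q mod 4 = 1" "q mod 8 = 1 \<longleftrightarrow> E = 1"
    and qA: "\<And>p. p \<in> A \<Longrightarrow> Legendre (int q) (int p) = \<epsilon> p"
    using prime_with_prescribed_residue_symbols[of A \<epsilon> "E = 1"] finA A \<epsilon> by blast
  have "q \<noteq> 1" "q > 0" using q(1) prime_gt_0_nat by auto
  then have q2: "2 < q" using q(2) by presburger
  have "\<not> q dvd N"
  proof
    assume "q dvd N"
    then have "q \<in> A" using q2 \<open>N > 0\<close> q(1) by (auto simp: A_def in_prime_factors_iff)
    then have "\<epsilon> q = 0" using qA[of q] by (simp add: Legendre_eq_0_iff[symmetric, THEN iffD1])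
    with \<epsilon>[OF \<open>q \<in> A\<close>] show False by simp
  qed
  then have "coprime q N" by (rule prime_imp_coprime[OF q(1)])
  then have cop: "coprime (int q) (int N)" by (simp only: coprime_int_iff)
  have "\<exists>r. int p dvd r\<^sup>2 + int q" if "p \<in> prime_factors N" for p
  proof (cases "p = 2")
    case True
    have "int p dvd 1\<^sup>2 + int q" using q(2) unfolding True by simp presburger
    then show ?thesis by blast
  next
    case False
    then have "p \<in> A" using that by (simp add: A_def)
    have "Legendre (-1 * int q) p = \<epsilon> p * \<epsilon> p"
      using A[OF \<open>p \<in> A\<close>] qA[OF \<open>p \<in> A\<close>] by (simp only: Legendre_mult \<epsilon>_def)
    also have "\<dots> = 1" using \<epsilon>[OF \<open>p \<in> A\<close>] by auto
    finally obtain r where "int p dvd r\<^sup>2 - (-1 * int q)" using Legendre_eq_1D by blast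
    then show ?thesis by auto
  qed
  then have "\<exists>r. int (\<Prod>(prime_factors N)) dvd r\<^sup>2 + int q"
    by (intro square_root_mod_prod_primes) (auto simp: in_prime_factors_iff)
  then obtain r where r: "int N dvd r\<^sup>2 + int q" unfolding prodN[symmetric] by blast
  have "Legendre (int p) (int q) = \<epsilon> p" if "p \<in> A" for p
  proof -
    have "p \<noteq> q" using that \<open>\<not> q dvd N\<close> by (auto simp: A_def in_prime_factors_iff)
    \<comment> \<open>This makes the sign in quadratic reciprocity trivial.\<close>
    have "even ((q - 1) div 2)" using q(2) by presburger
    then have "Legendre (int p) (int q) * Legendre (int q) (int p) = 1"
      using Quadratic_Reciprocity[of p q] A[OF that] q(1) q2 \<open>p \<noteq> q\<close> by simp
    then show ?thesis using qA[OF that] \<epsilon>[OF that] by auto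
  qed
  then have LA: "Legendre (int (\<Prod>A)) (int q) = E"
    using Legendre_prod[OF q(1) q2, of int A] by (simp add: E_def)
  have "Legendre (int N) (int q) = 1"
  proof (cases "even N")
    case True
    have "Legendre 2 (int q) = E" using Legendre_2[OF q(1,2)] q(3) E by auto
    moreover have "int N = 2 * int (\<Prod>A)" using N_even[OF True] by (metis of_nat_mult of_nat_numeral)
    ultimately have "Legendre (int N) (int q) = E * E"
      using Legendre_mult[OF q(1) q2, of 2 "int (\<Prod>A)"] LA by simp
    then show ?thesis using E by auto
  next
    case False
    then have "int (\<Prod>A) mod 4 = 1" using N4 N_odd[OF False] by presburger
    then have "E = 1" using E4 E by (auto simp: cong_def)
    then show ?thesis using LA N_odd[OF False] by simp
  qed
  then obtain s where s: "int q dvd s\<^sup>2 - int N" using Legendre_eq_1D by blast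
  \<comment> \<open>Since -1 is a square modulo \<open>q\<close>, \<open>ternary_isotropic\<close>
    also writes \<open>q\<close> as a sum of two rational squares, which splits the term with
    \<open>q\<close> below.\<close>
  have "Legendre (-1) q = 1" using Legendre_minus_1[OF q(1) q2] q(2) by simp
  then obtain r' where r': "int q dvd r'\<^sup>2 + 1" using Legendre_eq_1D[of "-1" "int q"] by auto
  obtain z u t where zut: "t \<noteq> 0" "z\<^sup>2 + int q * u\<^sup>2 = int N * t\<^sup>2"
    using ternary_isotropic[OF _ _ cop r s] \<open>N > 0\<close> \<open>q > 0\<close> by auto
  obtain z' u' t' where zut': "t' \<noteq> 0" "z'\<^sup>2 + u'\<^sup>2 = int q * t'\<^sup>2"
    using ternary_isotropic[of "int q" 1 r' 0] r' \<open>q > 0\<close> by auto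
  have "int N * (t * t')\<^sup>2 = (z\<^sup>2 + int q * u\<^sup>2) * t'\<^sup>2"
    unfolding zut(2) by (simp add: power_mult_distrib)
  also have "\<dots> = (z * t')\<^sup>2 + (int q * t'\<^sup>2) * u\<^sup>2"
    by (simp add: power_mult_distrib algebra_simps)
  also have "\<dots> = (z * t')\<^sup>2 + (z' * u)\<^sup>2 + (u' * u)\<^sup>2"
    unfolding zut'(2)[symmetric] by (simp add: power_mult_distrib algebra_simps)
  finally have "int N * \<bar>t * t'\<bar>\<^sup>2 = (z * t')\<^sup>2 + (z' * u)\<^sup>2 + (u' * u)\<^sup>2" by simp
  moreover have "\<bar>t * t'\<bar> > 0" using zut(1) zut'(1) by simp
  ultimately show ?thesis by (intro davenport_cassels_three_squares)
qed

text \<open>An odd square is 1 modulo 4, so removing the square part preserves the residue class and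
  leaves the squarefree case.\<close>

theorem three_squares:
  fixes N :: nat
  assumes "N mod 4 = 1 \<or> N mod 4 = 2"
  shows "\<exists>a b c :: int. int N = a\<^sup>2 + b\<^sup>2 + c\<^sup>2"
proof -
  define m k where "m = squarefree_part N" and "k = square_part N"
  have N: "N = m * k\<^sup>2" unfolding m_def k_def by (rule squarefree_decompose)
  have "odd k"
  proof
    assume "even k"
    then have "4 dvd k\<^sup>2" by (auto elim!: evenE simp: power2_eq_square)
    then have "4 dvd N" unfolding N by simp
    then show False using assms by presburger
  qed
  then have "k mod 4 = 1 \<or> k mod 4 = 3" by presburger
  then have "(k mod 4)\<^sup>2 mod 4 = 1" by auto
  then have "k\<^sup>2 mod 4 = 1" by (simp add: power_mod)
  then have "N mod 4 = m mod 4" unfolding N by (metis mod_mult_right_eq mult.right_neutral)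
  then obtain a b c :: int where "int m = a\<^sup>2 + b\<^sup>2 + c\<^sup>2"
    using squarefree_three_squares[of m] assms by (auto simp: m_def)
  then have "int N = (a * int k)\<^sup>2 + (b * int k)\<^sup>2 + (c * int k)\<^sup>2"
    unfolding N by (simp add: power_mult_distrib algebra_simps)
  then show ?thesis by blast
qed

section \<open>Large numbers\<close>

text \<open>The vectors \<open>(1,1,-2)\<close>, \<open>(2,2,2)\<close>, \<open>(3,-3,0)\<close> are orthogonal of norms 6, 12, 18. After permuting and
  changing signs, every integer vector of norm \<open>6 m\<close> lies in the lattice that they span.\<close>

lemma six_mult_three_squares_imp:
  fixes m A B C :: int
  assumes "6 * m = A\<^sup>2 + B\<^sup>2 + C\<^sup>2"
  shows "\<exists>x y z. m = x\<^sup>2 + 2 * y\<^sup>2 + 3 * z\<^sup>2"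
proof -
  have aux: "\<exists>x y z. m = x\<^sup>2 + 2 * y\<^sup>2 + 3 * z\<^sup>2"
    if eq: "6 * m = A\<^sup>2 + B\<^sup>2 + C\<^sup>2" and "even C" for A B C :: int
  proof -
    have sq3: "v\<^sup>2 mod 3 = (if v mod 3 = 0 then 0 else 1)" for v :: int
    proof -
      have "v mod 3 = 0 \<or> v mod 3 = 1 \<or> v mod 3 = 2" by presburger
      moreover have "v\<^sup>2 mod 3 = (v mod 3)\<^sup>2 mod 3" by (simp add: power_mod)
      ultimately show ?thesis by auto
    qed
    have "(A\<^sup>2 mod 3 + B\<^sup>2 mod 3 + C\<^sup>2 mod 3) mod 3 = (6 * m) mod 3"
      unfolding eq cong_def[symmetric] by (intro cong_add) simp_all
    also have "\<dots> = 0" by presburger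
    \<comment> \<open>Squares are 0 or 1 modulo 3, so either all or none of the three numbers are
      divisible by 3.\<close>
    finally have *: "(A mod 3 = 0) = (C mod 3 = 0)" "(B mod 3 = 0) = (C mod 3 = 0)"
      unfolding sq3 by (simp_all split: if_splits)
    have sign: "\<exists>v'. (v' = v \<or> v' = - v) \<and> 3 dvd v' - C" if "(v mod 3 = 0) = (C mod 3 = 0)" for v :: int
    proof -
      have "3 dvd v - C \<or> 3 dvd - v - C" using that by presburger
      then show ?thesis by blast
    qed
    obtain A' B' where A': "A' = A \<or> A' = - A" "3 dvd A' - C" and B': "B' = B \<or> B' = - B" "3 dvd B' - C"
      using sign[OF *(1)] sign[OF *(2)] by blast
    have eq': "6 * m = A'\<^sup>2 + B'\<^sup>2 + C\<^sup>2"
      using eq A' B' by auto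
    have "even (A'\<^sup>2 + B'\<^sup>2 + C\<^sup>2)"
      unfolding eq'[symmetric] by simp
    then have "even (A' + B')"
      using \<open>even C\<close> by simp
    have six: "6 dvd v" if "3 dvd v" "even v" for v :: int
      using that by presburger
    have "6 dvd A' - B'"
      using dvd_diff[OF A'(2) B'(2)] \<open>even (A' + B')\<close> by (intro six) simp_all
    then obtain z where z: "A' - B' = 6 * z" ..
    have "3 dvd (A' - C) + (B' - C) + 3 * C"
      using A' B' by (intro dvd_add) simp_all
    then have "6 dvd A' + B' + C"
      using \<open>even (A' + B')\<close> \<open>even C\<close> by (intro six) (simp_all add: ac_simps)
    then obtain y where y: "A' + B' + C = 6 * y" ..
    obtain x where x: "C = 2 * y - 2 * x"
      using \<open>even C\<close> by (metis evenE diff_diff_eq2 add_diff_cancel_left' right_diff_distrib)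
    have AB: "A' = x + 2 * y + 3 * z" "B' = x + 2 * y - 3 * z"
      using x y z by linarith+
    have "6 * m = 6 * (x\<^sup>2 + 2 * y\<^sup>2 + 3 * z\<^sup>2)"
      unfolding eq' x AB by (simp add: power2_eq_square algebra_simps)
    then have "m = x\<^sup>2 + 2 * y\<^sup>2 + 3 * z\<^sup>2" by simp
    then show ?thesis by blast
  qed
  have "even (A\<^sup>2 + B\<^sup>2 + C\<^sup>2)"
    unfolding assms[symmetric] by simp
  then consider "even A" | "even B" | "even C" by auto
  then show ?thesis
  proof cases
    case 1 then show ?thesis using aux[of B C A] assms by (simp add: ac_simps)
  next
    case 2 then show ?thesis using aux[of A C B] assms by (simp add: ac_simps)
  next
    case 3 then show ?thesis using aux[of A B C] assms by simp
  qed
qed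

text \<open>In terms of \<open>2 y + z \<omega>\<close> with \<open>\<omega>\<^sup>2 = -6\<close>, multiplication by \<open>(1 \<plusminus> 2 \<omega>) / 5\<close> is a rational
  isometry; it removes one common factor 5 of \<open>y\<close> and \<open>z\<close>, and for one of the two signs no more.\<close>

lemma binary_form_not_both_div_5:
  fixes y z :: int
  assumes "y \<noteq> 0 \<or> z \<noteq> 0"
  shows "\<exists>y' z'. 2 * y'\<^sup>2 + 3 * z'\<^sup>2 = 2 * y\<^sup>2 + 3 * z\<^sup>2 \<and> \<not> (5 dvd y' \<and> 5 dvd z')"
proof -
  have aux: "\<exists>y' z'. 2 * y'\<^sup>2 + 3 * z'\<^sup>2 = 25 ^ k * (2 * y\<^sup>2 + 3 * z\<^sup>2) \<and> \<not> (5 dvd y' \<and> 5 dvd z')"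
    if "\<not> (5 dvd y \<and> 5 dvd z)" for k and y z :: int
  proof (induction k)
    case 0
    show ?case using that by auto
  next
    case (Suc k)
    then obtain y' z' where IH: "2 * y'\<^sup>2 + 3 * z'\<^sup>2 = 25 ^ k * (2 * y\<^sup>2 + 3 * z\<^sup>2)"
      and nd: "\<not> (5 dvd y' \<and> 5 dvd z')" by blast
    \<comment> \<open>These are the products of \<open>2 * y' + z' * \<omega>\<close> with
      \<open>1 + 2 * \<omega>\<close> and \<open>1 - 2 * \<omega>\<close>, both of norm 25.\<close>
    have "2 * (y' - 6 * z')\<^sup>2 + 3 * (z' + 4 * y')\<^sup>2 = 25 * (2 * y'\<^sup>2 + 3 * z'\<^sup>2)"
      "2 * (y' + 6 * z')\<^sup>2 + 3 * (z' - 4 * y')\<^sup>2 = 25 * (2 * y'\<^sup>2 + 3 * z'\<^sup>2)"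
      by (simp_all add: power2_eq_square algebra_simps)
    moreover have "5 dvd y' \<and> 5 dvd z'" if "5 dvd y' - 6 * z'" "5 dvd y' + 6 * z'"
    proof -
      have "5 dvd 2 * y'" "5 dvd 12 * z'"
        using dvd_add[OF that] dvd_diff[OF that(2,1)] by simp_all
      then show ?thesis by presburger
    qed
    then have "\<not> 5 dvd y' - 6 * z' \<or> \<not> 5 dvd y' + 6 * z'"
      using nd by blast
    moreover have "25 * (2 * y'\<^sup>2 + 3 * z'\<^sup>2) = 25 ^ Suc k * (2 * y\<^sup>2 + 3 * z\<^sup>2)"
      using IH by simp
    ultimately show ?case by metis
  qed
  define g where "g = gcd y z"
  have "g \<noteq> 0" using assms by (simp add: g_def)
  define k where "k = multiplicity 5 g"
  have "5 ^ k dvd g" by (simp add: k_def multiplicity_dvd)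
  then obtain y1 z1 where yz: "y = 5 ^ k * y1" "z = 5 ^ k * z1"
    unfolding g_def by (meson dvd_def dvd_trans gcd_dvd1 gcd_dvd2)
  have "\<not> (5 dvd y1 \<and> 5 dvd z1)"
  proof
    assume "5 dvd y1 \<and> 5 dvd z1"
    then have "5 ^ Suc k dvd g"
      unfolding g_def yz by (simp add: mult.commute mult_dvd_mono)
    then have "Suc k \<le> k"
      unfolding k_def using \<open>g \<noteq> 0\<close> by (subst (asm) power_dvd_iff_le_multiplicity) auto
    then show False by simp
  qed
  then have "\<exists>y' z'. 2 * y'\<^sup>2 + 3 * z'\<^sup>2 = 25 ^ k * (2 * y1\<^sup>2 + 3 * z1\<^sup>2) \<and> \<not> (5 dvd y' \<and> 5 dvd z')"
    by (rule aux)
  also have "25 ^ k * (2 * y1\<^sup>2 + 3 * z1\<^sup>2) = 2 * y\<^sup>2 + 3 * z\<^sup>2"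
  proof -
    have "(25::int) ^ k = (5 ^ k)\<^sup>2"
      by (simp add: power2_eq_square flip: power_mult_distrib)
    then show ?thesis
      unfolding yz by (simp add: power_mult_distrib algebra_simps)
  qed
  finally show ?thesis .
qed

text \<open>For a coordinate \<open>v\<close> of weight \<open>c\<close>, Cauchy-Schwarz on the
  other three bounds \<open>(b - c * v)\<^sup>2\<close> by
  \<open>(10 - c) * (a - c * v\<^sup>2)\<close>. A negative \<open>v\<close> would make the left
  side exceed \<open>b\<^sup>2\<close>, while the right side is at most
  \<open>9 * a\<close>.\<close>

lemma coordinate_nonneg:
  fixes w x y z a b :: int
  assumes b: "w + 2 * x + 3 * y + 4 * z = b" and a: "w\<^sup>2 + 2 * x\<^sup>2 + 3 * y\<^sup>2 + 4 * z\<^sup>2 = a"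
    and "b \<ge> 0" "b\<^sup>2 \<ge> 9 * a"
  shows "w \<ge> 0" "x \<ge> 0" "y \<ge> 0" "z \<ge> 0"
proof -
  have key: "v \<ge> 0" if "1 \<le> c" "c \<le> 4" "(b - c * v)\<^sup>2 \<le> (10 - c) * (a - c * v\<^sup>2)" for c v :: int
  proof (rule ccontr)
    assume "\<not> v \<ge> 0"
    have "a \<ge> 0" unfolding a[symmetric] by simp
    have "b\<^sup>2 < (b - c * v)\<^sup>2"
      using \<open>b \<ge> 0\<close> \<open>\<not> v \<ge> 0\<close> that by (intro power_strict_mono) (auto simp: mult_pos_neg)
    also have "\<dots> \<le> (10 - c) * a"
    proof -
      have "0 \<le> (10 - c) * (c * v\<^sup>2)" using that by simp
      then show ?thesis using that(3) unfolding right_diff_distrib by linarith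
    qed
    also have "\<dots> \<le> 9 * a" using that \<open>a \<ge> 0\<close> by (intro mult_right_mono) auto
    finally show False using \<open>b\<^sup>2 \<ge> 9 * a\<close> by simp
  qed
  \<comment> \<open>Lagrange's identity: the defect is a sum of squares whose coefficients are
    products of two of the remaining weights.\<close>
  have "(10 - 1) * (a - 1 * w\<^sup>2) - (b - 1 * w)\<^sup>2 = 6 * (x - y)\<^sup>2 + 8 * (x - z)\<^sup>2 + 12 * (y - z)\<^sup>2"
    unfolding a[symmetric] b[symmetric] by (simp add: power2_eq_square algebra_simps)
  moreover have "0 \<le> \<dots>" by simp
  ultimately have "(b - 1 * w)\<^sup>2 \<le> (10 - 1) * (a - 1 * w\<^sup>2)" by linarith
  then show "w \<ge> 0" by (intro key[of 1 w]) simp_all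
  have "(10 - 2) * (a - 2 * x\<^sup>2) - (b - 2 * x)\<^sup>2 = 3 * (w - y)\<^sup>2 + 4 * (w - z)\<^sup>2 + 12 * (y - z)\<^sup>2"
    unfolding a[symmetric] b[symmetric] by (simp add: power2_eq_square algebra_simps)
  moreover have "0 \<le> \<dots>" by simp
  ultimately have "(b - 2 * x)\<^sup>2 \<le> (10 - 2) * (a - 2 * x\<^sup>2)" by linarith
  then show "x \<ge> 0" by (intro key[of 2 x]) simp_all
  have "(10 - 3) * (a - 3 * y\<^sup>2) - (b - 3 * y)\<^sup>2 = 2 * (w - x)\<^sup>2 + 4 * (w - z)\<^sup>2 + 8 * (x - z)\<^sup>2"
    unfolding a[symmetric] b[symmetric] by (simp add: power2_eq_square algebra_simps)
  moreover have "0 \<le> \<dots>" by simp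
  ultimately have "(b - 3 * y)\<^sup>2 \<le> (10 - 3) * (a - 3 * y\<^sup>2)" by linarith
  then show "y \<ge> 0" by (intro key[of 3 y]) simp_all
  have "(10 - 4) * (a - 4 * z\<^sup>2) - (b - 4 * z)\<^sup>2 = 2 * (w - x)\<^sup>2 + 3 * (w - y)\<^sup>2 + 6 * (x - y)\<^sup>2"
    unfolding a[symmetric] b[symmetric] by (simp add: power2_eq_square algebra_simps)
  moreover have "0 \<le> \<dots>" by simp
  ultimately have "(b - 4 * z)\<^sup>2 \<le> (10 - 4) * (a - 4 * z\<^sup>2)" by linarith
  then show "z \<ge> 0" by (intro key[of 4 z]) simp_all
qed

text \<open>Only residues modulo 5 matter, so suitable signs are found by evaluating all cases. They
  make the divisions by 5 in the inverted linear system exact.\<close>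

lemma mod_5_adjust:
  fixes b X Y Z a :: int
  assumes eq: "5 * a = b\<^sup>2 + X\<^sup>2 + 2 * Y\<^sup>2 + 3 * Z\<^sup>2" and b: "\<not> 5 dvd b" and YZ: "\<not> (5 dvd Y \<and> 5 dvd Z)"
  shows "\<exists>X' Y' Z'. X'\<^sup>2 = X\<^sup>2 \<and> Y'\<^sup>2 = Y\<^sup>2 \<and> Z'\<^sup>2 = Z\<^sup>2 \<and> 5 dvd b + X' - Y' \<and> 5 dvd b - X' - 2 * Z'"
proof -
  have "[(b mod 5)\<^sup>2 + (X mod 5)\<^sup>2 + 2 * (Y mod 5)\<^sup>2 + 3 * (Z mod 5)\<^sup>2 = 5 * a] (mod 5)"
    unfolding eq by (intro cong_add cong_mult cong_pow cong_refl) simp_all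
  then have sq: "((b mod 5)\<^sup>2 + (X mod 5)\<^sup>2 + 2 * (Y mod 5)\<^sup>2 + 3 * (Z mod 5)\<^sup>2) mod 5 = 0"
    by (simp add: cong_def)
  have tab: "\<forall>b\<in>set [1..4]. \<forall>X\<in>set [0..4]. \<forall>Y\<in>set [0..4]. \<forall>Z\<in>set [0..4::int].
      if (b\<^sup>2 + X\<^sup>2 + 2 * Y\<^sup>2 + 3 * Z\<^sup>2) mod 5 = 0 \<and> (Y \<noteq> 0 \<or> Z \<noteq> 0)
      then \<exists>e\<in>set [1,-1]. \<exists>f\<in>set [1,-1]. \<exists>g\<in>set [1,-1].
        (b + e * X - f * Y) mod 5 = 0 \<and> (b - e * X - 2 * (g * Z)) mod 5 = 0 else True"
    by code_simp
  have b5: "b mod 5 \<in> set [1..4]"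
    using b by (auto simp: dvd_eq_mod_eq_0 less_le zero_less_mult_iff)
  have v5: "v mod 5 \<in> set [0..4]" for v :: int
    by auto
  have nz: "Y mod 5 \<noteq> 0 \<or> Z mod 5 \<noteq> 0"
    using YZ by (auto simp: dvd_eq_mod_eq_0)
  have "\<exists>e\<in>set [1,-1]. \<exists>f\<in>set [1,-1]. \<exists>g\<in>set [1,-1].
      (b mod 5 + e * (X mod 5) - f * (Y mod 5)) mod 5 = 0 \<and> (b mod 5 - e * (X mod 5) - 2 * (g * (Z mod 5))) mod 5 = 0"
    using tab[rule_format, OF b5 v5[of X] v5[of Y] v5[of Z]] unfolding if_P[OF conjI[OF sq nz]] .
  then obtain e f g :: int where efg: "e \<in> set [1,-1]" "f \<in> set [1,-1]" "g \<in> set [1,-1]"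
    and "(b mod 5 + e * (X mod 5) - f * (Y mod 5)) mod 5 = 0" "(b mod 5 - e * (X mod 5) - 2 * (g * (Z mod 5))) mod 5 = 0"
    by (elim bexE conjE) (rule that)
  moreover have "[b mod 5 + e * (X mod 5) - f * (Y mod 5) = b + e * X - f * Y] (mod 5)"
    "[b mod 5 - e * (X mod 5) - 2 * (g * (Z mod 5)) = b - e * X - 2 * (g * Z)] (mod 5)"
    by (intro cong_add cong_diff cong_mult cong_refl; simp)+
  ultimately have "5 dvd b + e * X - f * Y" "5 dvd b - e * X - 2 * (g * Z)"
    by (simp_all only: cong_def dvd_eq_mod_eq_0)
  moreover have "e\<^sup>2 = 1" "f\<^sup>2 = 1" "g\<^sup>2 = 1"
    using efg by auto
  ultimately show ?thesis
    by (intro exI[of _ "e * X"] exI[of _ "f * Y"] exI[of _ "g * Z"]) (simp add: power_mult_distrib)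
qed

text \<open>With \<open>S = w + 4 z\<close> and \<open>T = 2 x + 3 y\<close> one has
  \<open>10 (w\<^sup>2 + 2 x\<^sup>2 + 3 y\<^sup>2 + 4 z\<^sup>2) - (S + T)\<^sup>2 = (S - T)\<^sup>2 + 8 (w - z)\<^sup>2 + 12 (x - y)\<^sup>2\<close>, which is
  inverted here with \<open>S = b + X\<close>, \<open>T = b - X\<close>, \<open>w - z = Y\<close>, \<open>x - y = Z\<close>.\<close>

lemma quaternary_representation:
  fixes a b X Y Z :: int
  assumes eq: "5 * a = b\<^sup>2 + X\<^sup>2 + 2 * Y\<^sup>2 + 3 * Z\<^sup>2" and "\<not> 5 dvd b" "Y \<noteq> 0 \<or> Z \<noteq> 0"
  shows "\<exists>w x y z. w + 2 * x + 3 * y + 4 * z = 2 * b \<and> w\<^sup>2 + 2 * x\<^sup>2 + 3 * y\<^sup>2 + 4 * z\<^sup>2 = 2 * a"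
proof -
  obtain Y1 Z1 where "2 * Y1\<^sup>2 + 3 * Z1\<^sup>2 = 2 * Y\<^sup>2 + 3 * Z\<^sup>2" and n5: "\<not> (5 dvd Y1 \<and> 5 dvd Z1)"
    using binary_form_not_both_div_5 assms(3) by blast
  then have eq1: "5 * a = b\<^sup>2 + X\<^sup>2 + 2 * Y1\<^sup>2 + 3 * Z1\<^sup>2"
    using eq by simp
  obtain X' Y' Z' where sq: "X'\<^sup>2 = X\<^sup>2" "Y'\<^sup>2 = Y1\<^sup>2" "Z'\<^sup>2 = Z1\<^sup>2"
    and dvd: "5 dvd b + X' - Y'" "5 dvd b - X' - 2 * Z'"
    using mod_5_adjust[OF eq1 assms(2) n5] by blast
  obtain y z where yz: "b + X' - Y' = 5 * z" "b - X' - 2 * Z' = 5 * y"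
    using dvd by (meson dvdE)
  have eq2: "5 * a = b\<^sup>2 + X'\<^sup>2 + 2 * Y'\<^sup>2 + 3 * Z'\<^sup>2"
    using eq1 sq by simp
  have b: "(z + Y') + 2 * (y + Z') + 3 * y + 4 * z = 2 * b"
    using yz by simp
  have "5 * ((z + Y')\<^sup>2 + 2 * (y + Z')\<^sup>2 + 3 * y\<^sup>2 + 4 * z\<^sup>2)
      = (5 * z + Y')\<^sup>2 + (5 * y + 2 * Z')\<^sup>2 + 4 * Y'\<^sup>2 + 6 * Z'\<^sup>2"
    by (simp add: power2_eq_square algebra_simps)
  also have "5 * z + Y' = b + X'" using yz by simp
  also have "5 * y + 2 * Z' = b - X'" using yz by simp
  also have "(b + X')\<^sup>2 + (b - X')\<^sup>2 + 4 * Y'\<^sup>2 + 6 * Z'\<^sup>2 = 5 * (2 * a)"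
    using eq2 by (simp add: power2_eq_square algebra_simps)
  finally have "(z + Y')\<^sup>2 + 2 * (y + Z')\<^sup>2 + 3 * y\<^sup>2 + 4 * z\<^sup>2 = 2 * a"
    by simp
  with b show ?thesis by blast
qed

lemma two_p5: "2 * p5 k = 3 * k\<^sup>2 - k"
proof -
  have "even (k * (3 * k - 1))" by auto
  then show ?thesis by (simp add: p5_def power2_eq_square algebra_simps)
qed

text \<open>If \<open>m\<close> is 3 modulo 4, then \<open>6 * m\<close> is 2 modulo 4; if
  \<open>m\<close> is 6 modulo 8, then \<open>6 * m\<close> is 4 times a number that is 1 modulo 4.
  So \<open>three_squares\<close> applies. Since \<open>m\<close> is 2 or 3 modulo 4, it is not a
  square.\<close>

lemma represented_by_ternary_form:
  fixes m :: int
  assumes "m > 0" "m mod 4 = 3 \<or> m mod 8 = 6"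
  shows "\<exists>x y z. m = x\<^sup>2 + 2 * y\<^sup>2 + 3 * z\<^sup>2 \<and> (y \<noteq> 0 \<or> z \<noteq> 0)"
proof -
  have nat_mod_4: "nat x mod 4 = nat (x mod 4)" if "x \<ge> 0" for x :: int
    using that by (simp add: nat_mod_distrib)
  have "\<exists>A B C. 6 * m = A\<^sup>2 + B\<^sup>2 + C\<^sup>2"
    using assms(2)
  proof
    assume "m mod 4 = 3"
    then have "(6 * m) mod 4 = 2" by presburger
    then have "nat (6 * m) mod 4 = 2" using nat_mod_4[of "6 * m"] assms(1) by simp
    then show ?thesis using three_squares[of "nat (6 * m)"] assms(1) by auto
  next
    assume "m mod 8 = 6"
    then obtain k where k: "m = 8 * k + 6" by (metis mult_div_mod_eq)
    then have "k \<ge> 0" using assms(1) by linarith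
    moreover have "(12 * k + 9) mod 4 = 1" by presburger
    ultimately have "nat (12 * k + 9) mod 4 = 1" using nat_mod_4[of "12 * k + 9"] by simp
    then obtain A B C where "12 * k + 9 = A\<^sup>2 + B\<^sup>2 + C\<^sup>2"
      using three_squares[of "nat (12 * k + 9)"] \<open>k \<ge> 0\<close> by auto
    then have "6 * m = (2 * A)\<^sup>2 + (2 * B)\<^sup>2 + (2 * C)\<^sup>2" using k by (simp add: power_mult_distrib)
    then show ?thesis by blast
  qed
  then obtain x y z where m: "m = x\<^sup>2 + 2 * y\<^sup>2 + 3 * z\<^sup>2" using six_mult_three_squares_imp by blast
  moreover have "y \<noteq> 0 \<or> z \<noteq> 0"
  proof (rule ccontr)
    assume "\<not> (y \<noteq> 0 \<or> z \<noteq> 0)"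
    then have sq: "m = x\<^sup>2" using m by simp
    have "x\<^sup>2 mod 4 = (x mod 4)\<^sup>2 mod 4" by (simp add: power_mod)
    moreover have "x mod 4 = 0 \<or> x mod 4 = 1 \<or> x mod 4 = 2 \<or> x mod 4 = 3" by presburger
    ultimately have "m mod 4 = 0 \<or> m mod 4 = 1" unfolding sq by auto
    then show False using assms(2) by presburger
  qed
  ultimately show ?thesis by blast
qed

text \<open>\<open>a mod 8 = 3\<close> puts \<open>5 * a - b\<^sup>2\<close> into an admissible
  class for either parity of \<open>b\<close>; \<open>upper\<close> makes it positive, and
  \<open>lower\<close> makes the coordinates nonnegative.\<close>

lemma pentagonal_representation:
  fixes n a b :: int
  assumes n: "n = 3 * a - b" and a8: "a mod 8 = 3" and b5: "\<not> 5 dvd b" and "b \<ge> 0"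
    and lower: "9 * a \<le> 2 * b\<^sup>2" and upper: "b\<^sup>2 < 5 * a"
  shows "\<exists>w\<ge>0. \<exists>x\<ge>0. \<exists>y\<ge>0. \<exists>z\<ge>0. n = p5 w + 2 * p5 x + 3 * p5 y + 4 * p5 z"
proof -
  define m where "m = 5 * a - b\<^sup>2"
  have m_mod: "m mod 4 = 3 \<or> m mod 8 = 6"
  proof (cases "even b")
    case True
    then obtain k where "b = 2 * k" ..
    then have "m = 5 * a - 4 * k\<^sup>2" by (simp add: m_def power_mult_distrib)
    then have "m mod 4 = 3" using a8 by presburger
    then show ?thesis ..
  next
    case False
    then have "b mod 8 = 1 \<or> b mod 8 = 3 \<or> b mod 8 = 5 \<or> b mod 8 = 7" by presburger
    moreover have "b\<^sup>2 mod 8 = (b mod 8)\<^sup>2 mod 8" by (simp add: power_mod)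
    ultimately have "b\<^sup>2 mod 8 = 1" by auto
    then have "m mod 8 = 6" unfolding m_def using a8 by presburger
    then show ?thesis ..
  qed
  have "m > 0" using upper by (simp add: m_def)
  obtain X Y Z where XYZ: "m = X\<^sup>2 + 2 * Y\<^sup>2 + 3 * Z\<^sup>2" "Y \<noteq> 0 \<or> Z \<noteq> 0"
    using represented_by_ternary_form[OF \<open>m > 0\<close> m_mod] by blast
  have eq: "5 * a = b\<^sup>2 + X\<^sup>2 + 2 * Y\<^sup>2 + 3 * Z\<^sup>2" using XYZ(1) by (simp add: m_def)
  obtain w x y z where lin: "w + 2 * x + 3 * y + 4 * z = 2 * b"
    and quad: "w\<^sup>2 + 2 * x\<^sup>2 + 3 * y\<^sup>2 + 4 * z\<^sup>2 = 2 * a"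
    using quaternary_representation[OF eq b5 XYZ(2)] by blast
  have "(2 * b)\<^sup>2 \<ge> 9 * (2 * a)" using lower by (simp add: power_mult_distrib)
  then have nonneg: "w \<ge> 0" "x \<ge> 0" "y \<ge> 0" "z \<ge> 0"
    using coordinate_nonneg[OF lin quad] \<open>b \<ge> 0\<close> by auto
  define S where "S = p5 w + 2 * p5 x + 3 * p5 y + 4 * p5 z"
  have "2 * S = 2 * p5 w + 2 * (2 * p5 x) + 3 * (2 * p5 y) + 4 * (2 * p5 z)"
    by (simp add: S_def)
  also have "\<dots> = 3 * (w\<^sup>2 + 2 * x\<^sup>2 + 3 * y\<^sup>2 + 4 * z\<^sup>2) - (w + 2 * x + 3 * y + 4 * z)"
    unfolding two_p5 by (simp add: algebra_simps)
  finally have "n = S" unfolding lin quad n by linarith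
  with nonneg show ?thesis unfolding S_def by blast
qed

text \<open>There are sixteen consecutive admissible \<open>a\<close>, hence two that are 3 modulo 8; their \<open>b\<close> differ by 24,
  so 5 does not divide both.\<close>

lemma pentagonal_representation_large:
  fixes n :: int
  assumes "n \<ge> 523626"
  shows "\<exists>w\<ge>0. \<exists>x\<ge>0. \<exists>y\<ge>0. \<exists>z\<ge>0. n = p5 w + 2 * p5 x + 3 * p5 y + 4 * p5 z"
proof -
  \<comment> \<open>As \<open>3 * a = n + b\<close>, the condition
    \<open>9 * a \<le> 2 * b\<^sup>2\<close> reads \<open>3 * n \<le> b * (2 * b - 3)\<close>;
    \<open>k\<close> is the least such \<open>b\<close>.\<close>
  define P where "P k \<longleftrightarrow> 3 * n \<le> int k * (2 * int k - 3)" for k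
  have "3 * n * 1 \<le> (3 * n + 2) * (1 + 6 * n)" using assms by (intro mult_mono) auto
  then have "P (nat (3 * n + 2))" using assms by (simp add: P_def)
  then have P: "P (LEAST k. P k)" by (rule LeastI)
  define k where "k = (LEAST k. P k)"
  have Pk: "P k" using P by (simp add: k_def)
  have "k \<noteq> 0"
  proof
    assume "k = 0"
    then show False using Pk assms by (simp add: P_def)
  qed
  then have "\<not> P (k - 1)" using not_less_Least[of "k - 1" P] by (simp add: k_def)
  define c where "c = int k - 1"
  have k_eq: "int k = c + 1" "int (k - 1) = c" using \<open>k \<noteq> 0\<close> by (simp_all add: c_def of_nat_diff)
  have lo: "3 * n \<le> (c + 1) * (2 * (c + 1) - 3)" and hi: "c * (2 * c - 3) < 3 * n"
    using Pk \<open>\<not> P (k - 1)\<close> unfolding P_def k_eq by simp_all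
  have "c \<ge> 0" using \<open>k \<noteq> 0\<close> by (simp add: c_def)
  \<comment> \<open>The upper bound will need \<open>c * (c - 864) \<ge> 20016\<close>, and 887 is
    the least nonnegative such \<open>c\<close>. The threshold for \<open>n\<close> fits exactly:
    \<open>3 * 523626 = 887 * 1771 + 1\<close>.\<close>
  have c: "c \<ge> 887"
  proof (rule ccontr)
    assume "\<not> c \<ge> 887"
    then have "c + 1 \<le> 887" by linarith
    have "(c + 1) * (2 * (c + 1) - 3) \<le> 887 * 1771"
    proof (cases "2 * (c + 1) - 3 \<ge> 0")
      case True
      then show ?thesis using \<open>c + 1 \<le> 887\<close> by (intro mult_mono) auto
    next
      case False
      then have "(c + 1) * (2 * (c + 1) - 3) \<le> 0"
        using \<open>c \<ge> 0\<close> by (intro mult_nonneg_nonpos) auto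
      then show ?thesis by (rule order_trans) simp
    qed
    with lo have "3 * n \<le> 887 * 1771" by (rule order_trans)
    then show False using assms by simp
  qed
  \<comment> \<open>The least \<open>a\<close> with \<open>3 * a - n \<ge> c + 1\<close>.\<close>
  define a0 where "a0 = (n + c + 3) div 3"
  have a0: "n + c + 1 \<le> 3 * a0" "3 * a0 \<le> n + c + 3" unfolding a0_def by linarith+
  define a1 where "a1 = a0 + (3 - a0) mod 8"
  have a1: "a1 mod 8 = 3" "a0 \<le> a1" "a1 \<le> a0 + 7"
    unfolding a1_def by presburger+
  have "\<not> 5 dvd 3 * a1 - n \<or> \<not> 5 dvd 3 * (a1 + 8) - n" by presburger
  then obtain a where a: "a = a1 \<or> a = a1 + 8" "\<not> 5 dvd 3 * a - n" by blast
  define b where "b = 3 * a - n"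
  have ab: "3 * a = n + b" by (simp add: b_def)
  have a8: "a mod 8 = 3" using a(1) a1(1) by presburger
  \<comment> \<open>Rounding up to \<open>a0\<close> adds at most 2 to \<open>c + 1\<close>, and
    moving to the chosen \<open>a\<close> at most \<open>3 * 15\<close>.\<close>
  have b_bounds: "c + 1 \<le> b" "b \<le> c + 48" using a(1) a1 a0 by (auto simp: b_def)
  show ?thesis
  proof (rule pentagonal_representation[OF _ a8])
    show "n = 3 * a - b" by (simp add: b_def)
    show "\<not> 5 dvd b" using a(2) by (simp add: b_def)
    show "b \<ge> 0" using b_bounds c by linarith
    have "(c + 1) * (2 * (c + 1) - 3) \<le> b * (2 * b - 3)"
      using b_bounds c by (intro mult_mono) auto
    then have "3 * n \<le> 2 * b\<^sup>2 - 3 * b" using lo by (simp add: power2_eq_square algebra_simps)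
    then show "9 * a \<le> 2 * b\<^sup>2" using ab by linarith
    have "b * (9 * b - 15) \<le> (c + 48) * (9 * (c + 48) - 15)"
      using b_bounds c by (intro mult_mono) auto
    moreover have "(887::int) * 23 \<le> c * (c - 864)"
      using c by (intro mult_mono) auto
    ultimately have "9 * b\<^sup>2 - 15 * b < 15 * n"
      using hi by (simp add: power2_eq_square algebra_simps)
    then show "b\<^sup>2 < 5 * a" using ab by linarith
  qed
qed

section \<open>Small numbers\<close>

text \<open>A set of positive integers is stored as a trie along the binary digits, least significant digit
  first, so that the simplifier can build and inspect it in reasonable time.\<close>

datatype trie = Tip | Nd bool trie trie

fun lookup :: "trie \<Rightarrow> num \<Rightarrow> bool" where
  "lookup Tip k = False"
| "lookup (Nd b l r) num.One = b"
| "lookup (Nd b l r) (num.Bit0 k) = lookup l k"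
| "lookup (Nd b l r) (num.Bit1 k) = lookup r k"

fun ins :: "num \<Rightarrow> trie \<Rightarrow> trie" where
  "ins num.One Tip = Nd True Tip Tip"
| "ins num.One (Nd b l r) = Nd True l r"
| "ins (num.Bit0 k) Tip = Nd False (ins k Tip) Tip"
| "ins (num.Bit0 k) (Nd b l r) = Nd b (ins k l) r"
| "ins (num.Bit1 k) Tip = Nd False Tip (ins k Tip)"
| "ins (num.Bit1 k) (Nd b l r) = Nd b l (ins k r)"

lemma lookup_ins: "lookup (ins k t) j \<Longrightarrow> j = k \<or> lookup t j"
  by (induction k t arbitrary: j rule: ins.induct) (case_tac j; auto)+

definition lookup_int :: "trie \<Rightarrow> int \<Rightarrow> bool" where
  "lookup_int t i \<longleftrightarrow> i > 0 \<and> lookup t (num_of_nat (nat i))"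

text \<open>Evaluation works on binary numerals directly, bypassing \<open>nat\<close> and
  \<open>num_of_nat\<close>.\<close>

lemma lookup_int_code [code]:
  "lookup_int t 0 = False" "lookup_int t (Int.Pos k) = lookup t k" "lookup_int t (Int.Neg k) = False"
  by (auto simp: lookup_int_def Num.nat_of_num_numeral[symmetric] nat_of_num_inverse)

definition ins_int :: "int \<Rightarrow> trie \<Rightarrow> trie" where
  "ins_int i t = (if i > 0 then ins (num_of_nat (nat i)) t else t)"

lemma ins_int_code [code]:
  "ins_int 0 t = t" "ins_int (Int.Pos k) t = ins k t" "ins_int (Int.Neg k) t = t"
  by (auto simp: ins_int_def Num.nat_of_num_numeral[symmetric] nat_of_num_inverse)

lemma num_of_nat_inj: "m > 0 \<Longrightarrow> n > 0 \<Longrightarrow> num_of_nat m = num_of_nat n \<Longrightarrow> m = n"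
  by (metis num_of_nat_inverse)

lemma lookup_ins_int: "lookup_int (ins_int i t) j \<Longrightarrow> j = i \<or> lookup_int t j"
  by (auto simp: lookup_int_def ins_int_def split: if_splits dest!: lookup_ins num_of_nat_inj[rotated 2])

text \<open>Stopping at the first value not below \<open>hi\<close> loses nothing on an increasing
  list such as \<open>map p5 [0..72]\<close>; \<open>set_row\<close> holds for every list.\<close>

fun row :: "int \<Rightarrow> int \<Rightarrow> int \<Rightarrow> int list \<Rightarrow> int list" where
  "row lo hi s [] = []"
| "row lo hi s (v # vs) =
    (if v < lo then row lo hi s vs else if v < hi then (s + v) # row lo hi s vs else [])"

fun ins_list :: "int list \<Rightarrow> trie \<Rightarrow> trie" where
  "ins_list [] t = t"
| "ins_list (k # ks) t = ins_list ks (ins_int k t)"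

fun add_rows :: "int \<Rightarrow> int \<Rightarrow> int list \<Rightarrow> int list \<Rightarrow> trie \<Rightarrow> trie" where
  "add_rows lo hi [] vs t = t"
| "add_rows lo hi (s # ss) vs t = add_rows lo hi ss vs (ins_list (row (lo - s) (hi - s) s vs) t)"

text \<open>Even numbers \<open>2 * q\<close> lie in the left branch, odd ones
  \<open>2 * q + 1\<close> in the right. Halving the bounds, rounded up or down respectively,
  transfers the interval to \<open>q\<close>.\<close>

fun full :: "int \<Rightarrow> int \<Rightarrow> trie \<Rightarrow> bool" where
  "full lo hi Tip \<longleftrightarrow> hi \<le> lo \<or> hi \<le> 1"
| "full lo hi (Nd b l r) \<longleftrightarrow> (b \<or> 1 < lo \<or> hi \<le> 1) \<and>
     full ((lo + 1) div 2) ((hi + 1) div 2) l \<and> full (lo div 2) (hi div 2) r"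

text \<open>\<open>2 * p5 51 = 7752\<close> and \<open>p5 72 = 7740\<close> exceed 7560, so larger
  arguments cannot contribute to the intervals checked below.\<close>

definition covered :: "int list \<Rightarrow> int \<Rightarrow> int \<Rightarrow> bool" where
  "covered offs lo hi \<longleftrightarrow>
     full lo hi (add_rows lo hi [d + 2 * p5 x. d \<leftarrow> offs, x \<leftarrow> [0..51]] (map p5 [0..72]) Tip)"

lemma set_row: "k \<in> set (row lo hi s vs) \<Longrightarrow> \<exists>v\<in>set vs. k = s + v"
  by (induction lo hi s vs rule: row.induct) (auto split: if_splits)

lemma lookup_ins_list: "lookup_int (ins_list ks t) k \<Longrightarrow> lookup_int t k \<or> k \<in> set ks"
  by (induction ks t rule: ins_list.induct) (auto dest: lookup_ins_int)

lemma lookup_add_rows: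
  "lookup_int (add_rows lo hi ss vs t) k \<Longrightarrow> lookup_int t k \<or> (\<exists>s\<in>set ss. \<exists>v\<in>set vs. k = s + v)"
  by (induction lo hi ss vs t rule: add_rows.induct) (auto dest!: lookup_ins_list set_row)

lemma full_lookup:
  "full lo hi t \<Longrightarrow> lo \<le> numeral k \<Longrightarrow> numeral k < hi \<Longrightarrow> lookup t k"
proof (induction t arbitrary: lo hi k)
  case Tip
  then show ?case
    using one_le_numeral[of k, where 'a = int] unfolding full.simps by linarith
next
  case (Nd b l r)
  have even_bounds: "lo \<le> q + q \<Longrightarrow> (lo + 1) div 2 \<le> q" "q + q < hi \<Longrightarrow> q < (hi + 1) div 2"
    and odd_bounds: "lo \<le> q + q + 1 \<Longrightarrow> lo div 2 \<le> q" "q + q + 1 < hi \<Longrightarrow> q < hi div 2" for q :: int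
    by linarith+
  show ?case
  proof (cases k)
    case One
    then show ?thesis using Nd.prems by auto
  next
    case (Bit0 j)
    have "full ((lo + 1) div 2) ((hi + 1) div 2) l"
      using Nd.prems(1) by simp
    then have "lookup l j"
      using even_bounds[of "numeral j"] Nd.prems(2,3) unfolding Bit0 numeral_Bit0
      by (intro Nd.IH(1))
    then show ?thesis by (simp add: Bit0)
  next
    case (Bit1 j)
    have "full (lo div 2) (hi div 2) r"
      using Nd.prems(1) by simp
    then have "lookup r j"
      using odd_bounds[of "numeral j"] Nd.prems(2,3) unfolding Bit1 numeral_Bit1
      by (intro Nd.IH(2))
    then show ?thesis by (simp add: Bit1)
  qed
qed

lemma full_lookup_int: "full lo hi t \<Longrightarrow> lo \<le> k \<Longrightarrow> k < hi \<Longrightarrow> 0 < k \<Longrightarrow> lookup_int t k"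
  using full_lookup[of lo hi t "num_of_nat (nat k)"] by (simp add: lookup_int_def numeral_num_of_nat_unfold)

lemma coveredD:
  assumes "covered offs lo hi" "lo \<le> r" "r < hi" "0 < r"
  shows "\<exists>d\<in>set offs. \<exists>w\<ge>0. \<exists>x\<ge>0. r = d + p5 w + 2 * p5 x"
proof -
  define ss where "ss = [d + 2 * p5 x. d \<leftarrow> offs, x \<leftarrow> [0..51]]"
  define vs where "vs = map p5 [0..72]"
  have "full lo hi (add_rows lo hi ss vs Tip)"
    using assms(1) unfolding covered_def ss_def vs_def .
  then have "lookup_int (add_rows lo hi ss vs Tip) r"
    using assms by (intro full_lookup_int)
  then obtain s v where "s \<in> set ss" "v \<in> set vs" "r = s + v"
    using lookup_add_rows[of lo hi ss vs Tip r] by (auto simp: lookup_int_def)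
  moreover from \<open>s \<in> set ss\<close> obtain d x where "d \<in> set offs" "0 \<le> x" "s = d + 2 * p5 x"
    unfolding ss_def by auto
  moreover from \<open>v \<in> set vs\<close> obtain w where "0 \<le> w" "v = p5 w"
    unfolding vs_def by auto
  ultimately have "r = d + p5 w + 2 * p5 x" by simp
  with \<open>d \<in> set offs\<close> \<open>0 \<le> w\<close> \<open>0 \<le> x\<close> show ?thesis by blast
qed

section \<open>Verification below 523626\<close>

definition low_offsets :: "(int \<times> int) list" where
  "low_offsets = [(0, 0), (0, 1), (1, 0), (0, 2), (1, 2), (1, 1), (2, 0), (2, 1), (2, 6), (1, 6), (2, 2), (0, 6),
     (1, 7), (0, 3), (0, 11), (1, 8)]"

text \<open>Only \<open>z\<close> varies here: the term \<open>3 * p5 y\<close> is spent on moving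
  \<open>n\<close> into a bounded window.\<close>

definition high_offsets :: "int list" where
  "high_offsets = [27, 24, 26, 25, 4, 6, 7, 23, 13, 17, 1, 8, 10, 29, 15, 31, 11, 3, 0, 5, 18]"

lemma covered_low: "covered (map (\<lambda>(y, z). 3 * p5 y + 4 * p5 z) low_offsets) 1 4452"
  by code_simp

lemma covered_high: "covered (map (\<lambda>z. 4 * p5 z) high_offsets) 4452 7560"
  by code_simp

lemma pentagonal_representation_small:
  fixes n :: int
  assumes "0 \<le> n" "n < 523626"
  shows "\<exists>w\<ge>0. \<exists>x\<ge>0. \<exists>y\<ge>0. \<exists>z\<ge>0. n = p5 w + 2 * p5 x + 3 * p5 y + 4 * p5 z"
proof -
  have low_nonneg: "0 \<le> y \<and> 0 \<le> z" if "(y, z) \<in> set low_offsets" for y z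
    using that unfolding low_offsets_def by auto
  have high_nonneg: "0 \<le> z" if "z \<in> set high_offsets" for z
    using that unfolding high_offsets_def by auto
  consider "n = 0" | "0 < n" "n < 4452" | "4452 \<le> n" using assms by linarith
  then show ?thesis
  proof cases
    case 1
    then have "n = p5 0 + 2 * p5 0 + 3 * p5 0 + 4 * p5 0" by (simp add: p5_def)
    then show ?thesis by blast
  next
    case 2
    then have "1 \<le> n" by simp
    then obtain d w x where d: "d \<in> set (map (\<lambda>(y, z). 3 * p5 y + 4 * p5 z) low_offsets)"
      and wx: "0 \<le> w" "0 \<le> x" "n = d + p5 w + 2 * p5 x"
      using coveredD[OF covered_low _ 2(2,1)] by blast
    obtain y z where yz: "(y, z) \<in> set low_offsets" and d_eq: "d = 3 * p5 y + 4 * p5 z"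
      using d by auto
    have "n = p5 w + 2 * p5 x + 3 * p5 y + 4 * p5 z" using wx(3) d_eq by simp
    then show ?thesis using wx(1,2) low_nonneg[OF yz] by blast
  next
    case 3
    \<comment> \<open>\<open>k - 1\<close> becomes the largest \<open>y\<close> with
      \<open>3 * p5 y + 4452 \<le> n\<close>. The next value of \<open>3 * p5\<close> is larger by
      \<open>3 * (3 * y + 1)\<close>, at most 3108 for \<open>y \<le> 345\<close>, so the remainder
      is below \<open>4452 + 3108 = 7560\<close>.\<close>
    define P where "P k \<longleftrightarrow> n < 3 * p5 (int k) + 4452" for k
    define k where "k = (LEAST k. P k)"
    have "P 346" using assms(2) by (simp add: P_def p5_def)
    then have "P k" "k \<le> 346" unfolding k_def by (rule LeastI, rule Least_le)
    have "k \<noteq> 0"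
    proof
      assume "k = 0"
      then show False using \<open>P k\<close> 3 by (simp add: P_def p5_def)
    qed
    then have "\<not> P (k - 1)" using not_less_Least[of "k - 1" P] by (simp add: k_def)
    define y where "y = int k - 1"
    have k_eq: "int k = y + 1" "int (k - 1) = y" using \<open>k \<noteq> 0\<close> by (simp_all add: y_def of_nat_diff)
    have lo: "3 * p5 y + 4452 \<le> n" and hi: "n < 3 * p5 (y + 1) + 4452"
      using \<open>P k\<close> \<open>\<not> P (k - 1)\<close> unfolding P_def k_eq by simp_all
    have "2 * p5 (y + 1) = 2 * p5 y + 2 * (3 * y + 1)"
      unfolding two_p5 by (simp add: power2_eq_square algebra_simps)
    also have "\<dots> = 2 * (p5 y + (3 * y + 1))" by simp
    finally have "2 = (0 :: int) \<or> p5 (y + 1) = p5 y + (3 * y + 1)" by (simp only: mult_cancel_left)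
    then have "p5 (y + 1) = p5 y + (3 * y + 1)" by simp
    moreover have "y \<le> 345" "0 \<le> y" using \<open>k \<le> 346\<close> \<open>k \<noteq> 0\<close> by (simp_all add: y_def)
    ultimately have "4452 \<le> n - 3 * p5 y" "n - 3 * p5 y < 7560" "0 < n - 3 * p5 y" using lo hi by linarith+
    then obtain d w x where d: "d \<in> set (map (\<lambda>z. 4 * p5 z) high_offsets)"
      and wx: "0 \<le> w" "0 \<le> x" "n - 3 * p5 y = d + p5 w + 2 * p5 x"
      using coveredD[OF covered_high] by blast
    obtain z where z: "z \<in> set high_offsets" and d_eq: "d = 4 * p5 z"
      using d by auto
    have "n = p5 w + 2 * p5 x + 3 * p5 y + 4 * p5 z" using wx(3) d_eq by simp
    then show ?thesis using wx(1,2) \<open>0 \<le> y\<close> high_nonneg[OF z] by blast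
  qed
qed

theorem theorem1p2:
  fixes n :: nat
  shows "\<exists>w x y z :: nat. int n = p5 (int w) + 2 * p5 (int x) + 3 * p5 (int y) + 4 * p5 (int z)"
proof -
  obtain w x y z where "w \<ge> 0" "x \<ge> 0" "y \<ge> 0" "z \<ge> 0" "int n = p5 w + 2 * p5 x + 3 * p5 y + 4 * p5 z"
  proof (cases "n < 523626")
    case True
    then show ?thesis using pentagonal_representation_small[of "int n"] that by auto
  next
    case False
    then show ?thesis using pentagonal_representation_large[of "int n"] that by auto
  qed
  then show ?thesis
    by (intro exI[of _ "nat w"] exI[of _ "nat x"] exI[of _ "nat y"] exI[of _ "nat z"]) simp
qed

end
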